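(* Let $\alpha,\beta>0$ be real numbers. There is a bijection between the set of similarities $\Phi$ of $\mathbb{R}^2$ that preserve the $x$-axis (as a set) and map $\mathcal{P}_\beta$ to $\mathcal{P}_\alpha$ (i.e. $\Phi\cdot\mathcal{P}_\beta=\mathcal{P}_\alpha$) and the set of elements $\begin{bmatrix} a&b\\c&d\end{bmatrix}\in \mathrm{PGL}_2(\mathbb{Z})$ such that $\dfrac{a\alpha+b}{c\alpha+d}=\beta$; under this bijection, a similarity is orientation-preserving if and only if the corresponding element lies in $\mathrm{PSL}_2(\mathbb{Z})$. In particular, $\mathcal{P}_\alpha$ and $\mathcal{P}_\beta$ are similar (respectively, similar via an orientation-preserving similarity) if and only if there exist integers $a,b,c,d$ with $ad-bc=\pm1$ (respectively, $ad-bc=+1$) such that $\dfrac{a\alpha+b}{c\alpha+d}=\beta$.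
   Context: A \emph{circle} in $\mathbb{R}^2$ is a Euclidean circle or a straight line, together with a choice of one of the two components of its complement, called its \emph{interior} (possibly the unbounded component; for a line, one of the two half-planes). Parallel lines are regarded as tangent (at infinity). An \emph{Apollonian circle packing} is a collection $\mathcal{P}$ of circles with pairwise disjoint interiors such that (i) $\mathcal{P}$ contains three mutually tangent circles, and (ii) any circle tangent to three mutually tangent circles of $\mathcal{P}$ (with interior chosen so that interiors are disjoint) is also in $\mathcal{P}$. Given a set $\mathcal{P}^{(0)}$ of three mutually tangent circles with disjoint interiors, let $\mathcal{P}^{(n+1)}$ consist of $\mathcal{P}^{(n)}$ together with all circles tangent to three mutually tangent circles in $\mathcal{P}^{(n)}$; the packing generated by $\mathcal{P}^{(0)}$ is $\bigcup_{n\ge0}\mathcal{P}^{(n)}$, which is an Apollonian circle packing. The curvature of a circle is the reciprocal of its radius; a line has curvature $0$. For $\alpha>0$, $\mathcal{P}_\alpha$ is the packing generated by $\{X,Y,L\}$, where $L$ is the $x$-axis (with interior the lower half-plane), $X$ is the circle of curvature $\alpha^2$ lying above $L$ and tangent to $L$ at the origin, and $Y$ is the circle of curvature $1$ lying above $L$, tangent to $L$ and tangent to $X$ on the right. A similarity of $\mathbb{R}^2$ is a map $\Phi(x)=\mu Ax+b$ with $\mu>0$, $A$ an orthogonal $2\times2$ matrix, $b\in\mathbb{R}^2$; it is orientation-preserving if $\det A=1$ and orientation-reversing if $\det A=-1$. For a packing $\mathcal{P}$, $\Phi\cdot\mathcal{P}=\{\Phi(C):C\in\mathcal{P}\}$;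 packings $\mathcal{P},\mathcal{P}'$ are similar if $\mathcal{P}'=\Phi\cdot\mathcal{P}$ for some similarity $\Phi$. $\mathrm{PGL}_2(\mathbb{Z})=\mathrm{GL}_2(\mathbb{Z})/\{\pm I\}$, and $\mathrm{PSL}_2(\mathbb{Z})$ is its subgroup of classes of matrices of determinant $1$. *)

theory Defs
  imports "HOL-Analysis.Analysis" "HOL-Algebra.Coset"
begin

section \<open>Oriented circles in the plane\<close>

text \<open>An oriented circle is the pair of its underlying curve and its interior.\<close>

type_synonym circ = "(real^2) set \<times> (real^2) set"

definition is_line :: "(real^2) set \<Rightarrow> bool" where
  "is_line S \<longleftrightarrow> affine S \<and> aff_dim S = 1"

definition is_circle :: "circ \<Rightarrow> bool" where
  "is_circle C \<longleftrightarrow>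
     (is_line (fst C) \<or> (\<exists>z r. 0 < r \<and> fst C = sphere z r)) \<and> snd C \<in> components (- fst C)"

text \<open>A line or round circle is tangent to a round circle iff they have exactly one common point.
  Two lines are tangent (at infinity) iff they are parallel and distinct; in the plane this
  means that they are disjoint. In particular, no circle is tangent to itself.\<close>

definition tangent :: "circ \<Rightarrow> circ \<Rightarrow> bool" where
  "tangent C D \<longleftrightarrow>
     (if is_line (fst C) \<and> is_line (fst D) then fst C \<inter> fst D = {}
      else \<exists>p. fst C \<inter> fst D = {p})"

definition mutually_tangent :: "circ \<Rightarrow> circ \<Rightarrow> circ \<Rightarrow> bool" where
  "mutually_tangent A B C \<longleftrightarrow> tangent A B \<and> tangent B C \<and> tangent A C"

section \<open>Generated Apollonian packings\<close>

text \<open>A circle tangent to three given ones is added with the interior that is disjoint from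
  the interiors of these three.\<close>

definition packing_step :: "circ set \<Rightarrow> circ set" where
  "packing_step P = P \<union> {D. is_circle D \<and>
     (\<exists>A\<in>P. \<exists>B\<in>P. \<exists>C\<in>P. mutually_tangent A B C \<and>
        (\<forall>E\<in>{A, B, C}. tangent D E \<and> snd D \<inter> snd E = {}))}"

definition generated_packing :: "circ set \<Rightarrow> circ set" where
  "generated_packing P0 = (\<Union>n. (packing_step ^^ n) P0)"

definition x_axis :: "(real^2) set" where
  "x_axis = {x. x $ 2 = 0}"

definition axis_circle :: circ where
  "axis_circle = (x_axis, {x. x $ 2 < 0})"

text \<open>The circle of curvature \<open>k\<close> above the \<open>x\<close>-axis and tangent to it at \<open>(t, 0)\<close>.\<close>

definition horocircle :: "real \<Rightarrow> real \<Rightarrow> circ" where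
  "horocircle t k = (sphere (vector [t, 1/k]) (1/k), ball (vector [t, 1/k]) (1/k))"

text \<open>The abscissa \<open>2 / \<alpha>\<close> is the unique positive one at which the circle of curvature 1
  touches the circle of curvature \<open>\<alpha>\<^sup>2\<close>; see \<open>tangent_horocircle_iff\<close> below.\<close>

definition pack :: "real \<Rightarrow> circ set" where
  "pack \<alpha> = generated_packing {horocircle 0 (\<alpha>\<^sup>2), horocircle (2/\<alpha>) 1, axis_circle}"

section \<open>Similarities\<close>

definition similarity :: "(real^2 \<Rightarrow> real^2) \<Rightarrow> bool" where
  "similarity \<Phi> \<longleftrightarrow> (\<exists>\<mu> A b. 0 < \<mu> \<and> orthogonal_matrix A \<and> \<Phi> = (\<lambda>x. \<mu> *\<^sub>R (A *v x) + b))"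

definition orientation_preserving :: "(real^2 \<Rightarrow> real^2) \<Rightarrow> bool" where
  "orientation_preserving \<Phi> \<longleftrightarrow>
     (\<exists>\<mu> A b. 0 < \<mu> \<and> orthogonal_matrix A \<and> det A = 1 \<and> \<Phi> = (\<lambda>x. \<mu> *\<^sub>R (A *v x) + b))"

definition image_packing :: "(real^2 \<Rightarrow> real^2) \<Rightarrow> circ set \<Rightarrow> circ set" where
  "image_packing \<Phi> P = (\<lambda>C. (\<Phi> ` fst C, \<Phi> ` snd C)) ` P"

definition similar :: "circ set \<Rightarrow> circ set \<Rightarrow> bool" where
  "similar P P' \<longleftrightarrow> (\<exists>\<Phi>. similarity \<Phi> \<and> P' = image_packing \<Phi> P)"

definition properly_similar :: "circ set \<Rightarrow> circ set \<Rightarrow> bool" where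
  "properly_similar P P' \<longleftrightarrow>
     (\<exists>\<Phi>. similarity \<Phi> \<and> orientation_preserving \<Phi> \<and> P' = image_packing \<Phi> P)"

section \<open>The groups \<open>PGL\<^sub>2(\<int>)\<close> and \<open>PSL\<^sub>2(\<int>)\<close>\<close>

definition GL2Z :: "(int^2^2) monoid" where
  "GL2Z = \<lparr>carrier = {M. invertible M}, mult = (**), one = mat 1\<rparr>"

definition PGL2Z :: "(int^2^2) set monoid" where
  "PGL2Z = GL2Z Mod {mat 1, - mat 1}"

definition PSL2Z :: "(int^2^2) set set" where
  "PSL2Z = {{mat 1, - mat 1} #>\<^bsub>GL2Z\<^esub> M | M. M \<in> carrier GL2Z \<and> det M = 1}"

text \<open>The relation does not depend on the representative \<open>M\<close> of the class \<open>g\<close>.\<close>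

definition moebius_sends :: "(int^2^2) set \<Rightarrow> real \<Rightarrow> real \<Rightarrow> bool" where
  "moebius_sends g x y \<longleftrightarrow>
     (\<exists>M\<in>g. of_int (M$2$1) * x + of_int (M$2$2) \<noteq> 0 \<and>
        (of_int (M$1$1) * x + of_int (M$1$2)) / (of_int (M$2$1) * x + of_int (M$2$2)) = y)"

section \<open>Consistency of the encoding\<close>

lemma not_is_line_sphere:
  assumes "0 < r"
  shows "\<not> is_line (sphere (z::real^2) r)"
proof
  assume "is_line (sphere z r)"
  hence a: "affine (sphere z r)" by (simp add: is_line_def)
  let ?e = "axis 1 1 :: real^2"
  have 1: "z + r *\<^sub>R ?e \<in> sphere z r" "z - r *\<^sub>R ?e \<in> sphere z r"
    using assms by (auto simp: dist_norm norm_axis_1)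
  have "(1/2) *\<^sub>R (z + r *\<^sub>R ?e) + (1/2) *\<^sub>R (z - r *\<^sub>R ?e) \<in> sphere z r"
    using a 1 unfolding affine_def by (metis field_sum_of_halves)
  moreover have "(1/2) *\<^sub>R (z + r *\<^sub>R ?e) + (1/2) *\<^sub>R (z - r *\<^sub>R ?e) = z"
    by (simp add: algebra_simps flip: scaleR_add_left)
  ultimately show False using assms by simp
qed

lemma component_of_separation:
  fixes U V S :: "(real^2) set"
  assumes "open U" "open V" "connected U" "U \<noteq> {}" "U \<inter> V = {}" "- S = U \<union> V"
  shows "U \<in> components (- S)"
  unfolding in_components_maximal
proof (intro conjI allI impI)
  fix D assume D: "D \<noteq> {} \<and> U \<subseteq> D \<and> D \<subseteq> - S \<and> connected D"
  have "U \<inter> D = {} \<or> V \<inter> D = {}"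
    by (rule connectedD[of D U V]) (use D assms in auto)
  thus "D = U" using D assms by auto
qed (use assms in auto)

lemma is_circle_axis_circle: "is_circle axis_circle"
proof -
  have e: "x_axis = {x. axis 2 1 \<bullet> x = 0}"
    by (simp add: x_axis_def inner_axis')
  have n: "axis 2 1 \<noteq> (0::real^2)" by (simp add: axis_eq_0_iff)
  have "is_line x_axis"
    unfolding is_line_def e using n by (simp add: affine_hyperplane aff_dim_hyperplane)
  moreover have "{x::real^2. x $ 2 < 0} \<in> components (- x_axis)"
  proof (rule component_of_separation)
    show "open {x::real^2. x $ 2 < 0}" "open {x::real^2. x $ 2 > 0}"
      using open_halfspace_lt[of "axis 2 1 :: real^2" 0] open_halfspace_gt[of 0 "axis 2 1 :: real^2"]
      by (simp_all add: inner_axis')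
    show "connected {x::real^2. x $ 2 < 0}"
      using convex_connected[OF convex_halfspace_lt[of "axis 2 1 :: real^2" 0]]
      by (simp add: inner_axis')
    have "vector [0, -1] \<in> {x::real^2. x $ 2 < 0}" by simp
    thus "{x::real^2. x $ 2 < 0} \<noteq> {}" by blast
  qed (auto simp: x_axis_def)
  ultimately show ?thesis by (simp add: is_circle_def axis_circle_def)
qed

lemma is_circle_horocircle:
  assumes "0 < k"
  shows "is_circle (horocircle t k)"
proof -
  define z :: "real^2" where "z = vector [t, 1/k]"
  have "ball z (1/k) \<in> components (- sphere z (1/k))"
    by (rule component_of_separation[where V = "- cball z (1/k)"]) (use assms in auto)
  moreover have "\<exists>w r. 0 < r \<and> sphere z (1/k) = sphere w r"
    using assms by (intro exI[of _ z] exI[of _ "1/k"]) simp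
  ultimately show ?thesis by (simp add: is_circle_def horocircle_def z_def)
qed

lemma mem_sphere_vec2:
  assumes "0 < r"
  shows "p \<in> sphere (vector [a, b] :: real^2) r \<longleftrightarrow> (p$1 - a)\<^sup>2 + (p$2 - b)\<^sup>2 = r\<^sup>2"
proof -
  have "p \<in> sphere (vector [a, b] :: real^2) r \<longleftrightarrow> (norm (p - vector [a, b]))\<^sup>2 = r\<^sup>2"
    using assms by (simp add: dist_norm norm_minus_commute)
  also have "(norm (p - vector [a, b]))\<^sup>2 = (p$1 - a)\<^sup>2 + (p$2 - b)\<^sup>2"
    by (simp only: power2_norm_eq_inner inner_vec_def sum_2) (simp add: power2_eq_square)
  finally show ?thesis .
qed

lemma tangent_horocircle_iff:
  assumes "0 < \<alpha>" "0 < t"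
  shows "tangent (horocircle 0 (\<alpha>\<^sup>2)) (horocircle t 1) \<longleftrightarrow> t = 2/\<alpha>"
proof -
  define r where "r = 1/\<alpha>\<^sup>2"
  have r: "0 < r" using assms by (simp add: r_def)
  define I where "I = sphere (vector [0, r] :: real^2) r \<inter> sphere (vector [t, 1]) 1"
  have mem: "p \<in> I \<longleftrightarrow> (p$1)\<^sup>2 + (p$2 - r)\<^sup>2 = r\<^sup>2 \<and> (p$1 - t)\<^sup>2 + (p$2 - 1)\<^sup>2 = 1" for p
    unfolding I_def Int_iff mem_sphere_vec2[OF r] mem_sphere_vec2[OF zero_less_one] by simp
  have tan: "tangent (horocircle 0 (\<alpha>\<^sup>2)) (horocircle t 1) \<longleftrightarrow> (\<exists>p. I = {p})"
    using not_is_line_sphere[OF r] by (simp add: tangent_def horocircle_def I_def r_def)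
  have sq: "t = 2/\<alpha> \<longleftrightarrow> t\<^sup>2 = 4 * r"
  proof -
    have "4 * r = (2/\<alpha>)\<^sup>2" by (simp add: r_def power_divide)
    thus ?thesis using assms by (simp add: power2_eq_iff_nonneg)
  qed
  have "t\<^sup>2 = 4 * r" if "I = {p}" for p
  proof -
    define x y D h where "x = p$1" and "y = p$2" and "D = t\<^sup>2 + (1 - r)\<^sup>2"
      and "h = p$1 * (r - 1) + (p$2 - r) * t"
    have D: "D > 0" using assms by (simp add: D_def add_pos_nonneg)
    have 1: "x\<^sup>2 + (y - r)\<^sup>2 = r\<^sup>2" and 2: "(x - t)\<^sup>2 + (y - 1)\<^sup>2 = 1"
      using that mem[of p] by (auto simp: x_def y_def)
    define m where "m = 2 * h / D"
    have m: "m * D = 2 * (x * (r - 1) + (y - r) * t)"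
      using D by (simp add: m_def h_def x_def y_def)
    define q :: "real^2" where "q = vector [x - m * (r - 1), y - m * t]"
    have "(q$1)\<^sup>2 + (q$2 - r)\<^sup>2 = x\<^sup>2 + (y - r)\<^sup>2"
      using m unfolding D_def q_def vector_2 by algebra
    moreover have "(q$1 - t)\<^sup>2 + (q$2 - 1)\<^sup>2 = (x - t)\<^sup>2 + (y - 1)\<^sup>2"
      using m unfolding D_def q_def vector_2 by algebra
    ultimately have "q \<in> I" using 1 2 mem by simp
    hence "q = p" using that by simp
    hence "m * t = 0" by (auto simp: q_def y_def vec_eq_iff forall_2)
    hence "m = 0" using assms by simp
    hence 3: "x * (r - 1) + (y - r) * t = 0" using m by simp
    define k where "k = x * t + (y - r) * (1 - r)"
    have "k\<^sup>2 = r\<^sup>2 * D" using 1 3 unfolding k_def D_def by algebra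
    moreover have "2 * k = t\<^sup>2 + 2 * r\<^sup>2 - 2 * r" using 1 2 unfolding k_def by algebra
    ultimately have "t\<^sup>2 * (t\<^sup>2 - 4 * r) = 0" unfolding D_def by algebra
    thus ?thesis using assms by simp
  qed
  moreover have "\<exists>p. I = {p}" if t: "t\<^sup>2 = 4 * r"
  proof -
    define s where "s = r / (1 + r)"
    have s: "s * (1 + r) = r" using r by (simp add: s_def)
    define p0 :: "real^2" where "p0 = vector [s * t, r + s * (1 - r)]"
    have "p0 \<in> I"
      unfolding mem p0_def vector_2
    proof
      have "(s * t)\<^sup>2 + (r + s * (1 - r) - r)\<^sup>2 = s\<^sup>2 * (t\<^sup>2 + (1 - r)\<^sup>2)"
        by (simp add: power2_eq_square algebra_simps)
      also have "\<dots> = (s * (1 + r))\<^sup>2"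
        unfolding t by (simp add: power2_eq_square algebra_simps)
      finally show "(s * t)\<^sup>2 + (r + s * (1 - r) - r)\<^sup>2 = r\<^sup>2"
        unfolding s .
      have "(s * t - t)\<^sup>2 + (r + s * (1 - r) - 1)\<^sup>2 = (1 - s)\<^sup>2 * (t\<^sup>2 + (1 - r)\<^sup>2)"
        by (simp add: power2_eq_square algebra_simps)
      also have "\<dots> = (1 + r - s * (1 + r))\<^sup>2"
        unfolding t by (simp add: power2_eq_square algebra_simps)
      finally show "(s * t - t)\<^sup>2 + (r + s * (1 - r) - 1)\<^sup>2 = 1"
        unfolding s by simp
    qed
    moreover have "p = p0" if "p \<in> I" for p
    proof -
      have "(p$1)\<^sup>2 + (p$2 - r)\<^sup>2 = r\<^sup>2" "(p$1 - t)\<^sup>2 + (p$2 - 1)\<^sup>2 = 1"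
        using that mem by auto
      hence "(p$1 - p0$1)\<^sup>2 + (p$2 - p0$2)\<^sup>2 = 0"
        unfolding p0_def vector_2 using s t by algebra
      thus ?thesis by (simp add: sum_power2_eq_zero_iff vec_eq_iff forall_2)
    qed
    ultimately show ?thesis by blast
  qed
  ultimately show ?thesis using tan sq by blast
qed

end

theory Submission
  imports Defs
begin

text \<open>An oriented circle is a vector of norm 1 for a Lorentz form of signature (3,1), and tangency with
  disjoint interiors is the value \<open>-1\<close> of the form. A Descartes quadruple is a basis with a fixed Gram
  matrix; replacing one circle by the other one tangent to the remaining three is a reflection, and
  two circles are the only ones tangent to three given ones. Along a reduced word of such swaps the form with
  a fixed circle of the initial quadruple does not change until that circle is swapped, and afterwards
  the newest circle is always the farthest. Hence the circles so obtained have pairwise disjoint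
  interiors, mutually tangent triples of them lie in common quadruples, and they exhaust the packing.
  With the axis as fixed circle, the circles of \<open>pack \<alpha>\<close> tangent to the axis are the Ford circles of the primitive
  vectors \<open>\<plusminus>(m, n)\<close>, of curvature \<open>(m\<alpha> + n)\<^sup>2\<close>, and two of them are tangent iff the vectors have determinant
  \<open>\<plusminus>1\<close>; by the Euclidean algorithm any such pair generates the packing together with the axis. A similarity fixing the
  axis is therefore the choice of the images \<open>\<plusminus>(a, b)\<close> and \<open>\<plusminus>(c, d)\<close> of the two generating circles, and
  comparing curvatures gives \<open>(a\<alpha> + b) / (c\<alpha> + d) = \<beta>\<close>.
  If a similarity moves the axis to another line, that line and the axis bound a strip, and the half-turn about the
  centre of an inscribed circle of the packing swaps the two lines and preserves the packing.\<close>

section \<open>Oriented circles as vectors of Lorentz norm one\<close>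

type_synonym lvec = "real \<times> real \<times> real \<times> real"

text \<open>The polarisation of x^2 + y^2 - b e. For circles of positive curvature with radii r, s
  and centres at distance d it equals (r^2 + s^2 - d^2) / (2 r s), hence -1 at external and 1 at
  internal tangency.\<close>

fun lorentz :: "lvec \<Rightarrow> lvec \<Rightarrow> real" where
  "lorentz (b, x, y, e) (b', x', y', e') = x * x' + y * y' - (b * e' + b' * e) / 2"

text \<open>For \<open>b \<noteq> 0\<close> the vector \<open>(b, x, y, e)\<close> is the circle of signed curvature \<open>b\<close> and centre \<open>(x/b, y/b)\<close>,
  negative curvature meaning that the interior is unbounded; for \<open>b = 0\<close> it is a half-plane.\<close>

fun circ_fun :: "lvec \<Rightarrow> real^2 \<Rightarrow> real" where
  "circ_fun (b, x, y, e) p = b * ((p$1)\<^sup>2 + (p$2)\<^sup>2) - 2 * x * p$1 - 2 * y * p$2 + e"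

definition circ_of :: "lvec \<Rightarrow> circ" where
  "circ_of v = ({p. circ_fun v p = 0}, {p. circ_fun v p < 0})"

text \<open>Completing the square: norm one eliminates \<open>e\<close>, and the factor
  \<open>b\<close> avoids division.\<close>

lemma circ_fun_shift:
  assumes "lorentz (b, x, y, e) (b, x, y, e) = 1"
  shows "b * circ_fun (b, x, y, e) p = (b * p$1 - x)\<^sup>2 + (b * p$2 - y)\<^sup>2 - 1"
proof -
  have "e * b = x\<^sup>2 + y\<^sup>2 - 1" using assms by (simp add: power2_eq_square algebra_simps)
  thus ?thesis by simp algebra
qed

lemma mem_ball_vec2:
  assumes "0 < r"
  shows "p \<in> ball (vector [a, b] :: real^2) r \<longleftrightarrow> (p$1 - a)\<^sup>2 + (p$2 - b)\<^sup>2 < r\<^sup>2"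
proof -
  have "p \<in> ball (vector [a, b] :: real^2) r \<longleftrightarrow> (norm (p - vector [a, b]))\<^sup>2 < r\<^sup>2"
    using assms power_strict_mono[of "norm (p - vector [a, b])" r 2]
      power_less_imp_less_base[of "norm (p - vector [a, b])" 2 r]
    by (auto simp: dist_norm norm_minus_commute)
  also have "(norm (p - vector [a, b]))\<^sup>2 = (p$1 - a)\<^sup>2 + (p$2 - b)\<^sup>2"
    by (simp only: power2_norm_eq_inner inner_vec_def sum_2) (simp add: power2_eq_square)
  finally show ?thesis .
qed

lemma circ_of_pos:
  assumes "lorentz (b, x, y, e) (b, x, y, e) = 1" "0 < b"
  shows "circ_of (b, x, y, e) = (sphere (vector [x/b, y/b]) (1/b), ball (vector [x/b, y/b]) (1/b))"
proof -
  have r: "0 < 1/b" using assms by simp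
  have 1: "(p$1 - x/b)\<^sup>2 + (p$2 - y/b)\<^sup>2 - (1/b)\<^sup>2 = circ_fun (b, x, y, e) p / b" for p :: "real^2"
  proof -
    have "(p$1 - x/b)\<^sup>2 + (p$2 - y/b)\<^sup>2 - (1/b)\<^sup>2
        = ((b * p$1 - x)\<^sup>2 + (b * p$2 - y)\<^sup>2 - 1) / b\<^sup>2"
      using assms by (simp add: field_simps power2_eq_square)
    also have "\<dots> = circ_fun (b, x, y, e) p / b"
      unfolding circ_fun_shift[OF assms(1), symmetric] using assms by (simp add: power2_eq_square)
    finally show ?thesis .
  qed
  have "p \<in> sphere (vector [x/b, y/b]) (1/b) \<longleftrightarrow> circ_fun (b, x, y, e) p = 0" for p
    unfolding mem_sphere_vec2[OF r] using 1[of p] assms(2) by (smt (verit) divide_eq_0_iff)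
  moreover have "p \<in> ball (vector [x/b, y/b]) (1/b) \<longleftrightarrow> circ_fun (b, x, y, e) p < 0" for p
    unfolding mem_ball_vec2[OF r] using 1[of p] assms(2) by (smt (verit) divide_less_0_iff)
  ultimately show ?thesis unfolding circ_of_def by blast
qed

lemma circ_of_neg:
  assumes "lorentz (b, x, y, e) (b, x, y, e) = 1" "b < 0"
  shows "circ_of (b, x, y, e) = (sphere (vector [x/b, y/b]) (-1/b), - cball (vector [x/b, y/b]) (-1/b))"
proof -
  have "circ_of (-b, -x, -y, -e) = (sphere (vector [x/b, y/b]) (-1/b), ball (vector [x/b, y/b]) (-1/b))"
    using circ_of_pos[of "-b" "-x" "-y" "-e"] assms by simp
  moreover have "circ_fun (-b, -x, -y, -e) p = - circ_fun (b, x, y, e) p" for p by simp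
  ultimately have "{p. circ_fun (b, x, y, e) p = 0} = sphere (vector [x/b, y/b]) (-1/b)"
      "{p. circ_fun (b, x, y, e) p > 0} = ball (vector [x/b, y/b]) (-1/b)"
    by (auto simp: circ_of_def simp del: circ_fun.simps)
  moreover have "{p. circ_fun (b, x, y, e) p < 0} = - ({p. circ_fun (b, x, y, e) p = 0} \<union> {p. circ_fun (b, x, y, e) p > 0})"
    by (auto simp del: circ_fun.simps)
  ultimately show ?thesis unfolding circ_of_def
    by (simp del: circ_fun.simps) auto
qed

lemma inner_2: "u \<bullet> v = u$1 * v$1 + u$2 * v$2" for u v :: "real^2"
  by (simp add: inner_vec_def sum_2)

lemma is_line_circ_of:
  assumes "lorentz (b, x, y, e) (b, x, y, e) = 1"
  shows "is_line (fst (circ_of (b, x, y, e))) \<longleftrightarrow> b = 0"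
proof -
  have "is_line (fst (circ_of (b, x, y, e)))" if "b = 0"
  proof -
    have "fst (circ_of (b, x, y, e)) = {p. vector [2*x, 2*y] \<bullet> p = e}"
      using that by (auto simp: circ_of_def inner_2)
    moreover have "vector [2*x, 2*y] \<noteq> (0::real^2)"
      using assms that by (auto simp: vec_eq_iff forall_2)
    ultimately show ?thesis unfolding is_line_def by (simp add: affine_hyperplane aff_dim_hyperplane)
  qed
  moreover have "\<not> is_line (fst (circ_of (b, x, y, e)))" if "b \<noteq> 0"
  proof (cases "b > 0")
    case True
    show ?thesis using not_is_line_sphere[of "1/b"] circ_of_pos[OF assms True] True by simp
  next
    case False
    show ?thesis using not_is_line_sphere[of "-1/b"] circ_of_neg[OF assms] False that by simp
  qed
  ultimately show ?thesis by blast
qed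

lemma components_of_separation:
  fixes U V S :: "(real^2) set"
  assumes "open U" "open V" "connected U" "connected V" "U \<noteq> {}" "V \<noteq> {}" "U \<inter> V = {}" "- S = U \<union> V"
  shows "components (- S) = {U, V}"
proof
  have U: "U \<in> components (- S)" by (rule component_of_separation[of U V]) (use assms in auto)
  have V: "V \<in> components (- S)" by (rule component_of_separation[of V U]) (use assms in auto)
  show "{U, V} \<subseteq> components (- S)" using U V by simp
  show "components (- S) \<subseteq> {U, V}"
  proof
    fix D assume D: "D \<in> components (- S)"
    then have "D \<noteq> {}" "D \<subseteq> U \<union> V"
      using in_components_nonempty[OF D] in_components_subset[OF D] assms(8) by auto
    then have "D \<inter> U \<noteq> {} \<or> D \<inter> V \<noteq> {}" by auto
    thus "D \<in> {U, V}" using components_nonoverlap[OF D U] components_nonoverlap[OF D V] by auto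
  qed
qed

lemma components_sphere:
  assumes "0 < r"
  shows "components (- sphere (z::real^2) r) = {ball z r, - cball z r}"
proof (rule components_of_separation)
  show "connected (- cball z r)" by (rule connected_complement_bounded_convex) auto
  show "- cball z r \<noteq> {}" using not_compact_UNIV compact_cball by (metis Compl_empty_eq double_complement)
qed (use assms in auto)

lemma components_hyperplane:
  assumes "a \<noteq> (0::real^2)"
  shows "components (- {p. a \<bullet> p = c}) = {{p. a \<bullet> p < c}, {p. a \<bullet> p > c}}"
proof (rule components_of_separation)
  have "a \<bullet> ((c - 1) / (a \<bullet> a)) *\<^sub>R a < c" "a \<bullet> ((c + 1) / (a \<bullet> a)) *\<^sub>R a > c" using assms by auto
  thus "{p. a \<bullet> p < c} \<noteq> {}" "{p. a \<bullet> p > c} \<noteq> {}" by blast+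
qed (auto simp: open_halfspace_lt open_halfspace_gt convex_halfspace_lt convex_halfspace_gt convex_connected)

lemma circ_of_line:
  "circ_of (0, x, y, e) = ({p. vector [2*x, 2*y] \<bullet> p = e}, {p. vector [2*x, 2*y] \<bullet> p > e})"
  by (auto simp: circ_of_def inner_2)

lemma is_circle_circ_of:
  assumes "lorentz v v = 1"
  shows "is_circle (circ_of v)"
proof -
  obtain b x y e where v: "v = (b, x, y, e)" by (cases v)
  note n = assms[unfolded v]
  consider "b > 0" | "b < 0" | "b = 0" by linarith
  thus ?thesis
  proof cases
    case 1
    thus ?thesis unfolding v circ_of_pos[OF n 1] is_circle_def fst_conv snd_conv
      by (auto simp: components_sphere intro!: disjI2 exI[of _ "1/b"])
  next
    case 2
    hence "0 < -1/b" by simp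
    thus ?thesis unfolding v circ_of_neg[OF n 2] is_circle_def fst_conv snd_conv
      by (auto simp: components_sphere intro!: disjI2 exI[of _ "-1/b"] simp del: divide_minus_left)
  next
    case 3
    have "vector [2*x, 2*y] \<noteq> (0::real^2)" using n 3 by (auto simp: vec_eq_iff forall_2)
    thus ?thesis using is_line_circ_of[OF n] 3 unfolding v is_circle_def
      by (simp add: circ_of_line components_hyperplane)
  qed
qed

text \<open>Normalise the normal vector of a line, or divide the equation of a round circle by its
  radius; the sign of the resulting vector selects the interior.\<close>

lemma is_circle_imp_circ_of:
  assumes "is_circle C"
  obtains v where "lorentz v v = 1" "C = circ_of v"
proof (cases "is_line (fst C)")
  case True
  have "affine hull (fst C) = fst C" "aff_dim (fst C) = int (DIM(real^2) - 1)"
    using True by (auto simp: is_line_def)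
  then have "\<exists>a c. a \<noteq> 0 \<and> fst C = {p. a \<bullet> p = c}"
    using iffD1[OF aff_dim_eq_hyperplane, of "fst C"] by (simp only:)
  then obtain a c where a: "a \<noteq> 0" "fst C = {p. a \<bullet> p = c}" by blast
  define N where "N = norm a"
  have N: "N > 0" using a by (simp add: N_def)
  have N2: "N\<^sup>2 = (a$1)\<^sup>2 + (a$2)\<^sup>2"
    unfolding N_def power2_norm_eq_inner inner_2 by (simp add: power2_eq_square)
  have eq: "vector [2*(a$1/N), 2*(a$2/N)] \<bullet> p = 2*c/N \<longleftrightarrow> a \<bullet> p = c"
    "vector [2*(a$1/N), 2*(a$2/N)] \<bullet> p > 2*c/N \<longleftrightarrow> a \<bullet> p > c"
    "vector [2*(-a$1/N), 2*(-a$2/N)] \<bullet> p = -2*c/N \<longleftrightarrow> a \<bullet> p = c"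
    "vector [2*(-a$1/N), 2*(-a$2/N)] \<bullet> p > -2*c/N \<longleftrightarrow> a \<bullet> p < c" for p
  proof -
    have "vector [2*(a$1/N), 2*(a$2/N)] \<bullet> p = 2 * (a \<bullet> p) / N"
      "vector [2*(-a$1/N), 2*(-a$2/N)] \<bullet> p = - 2 * (a \<bullet> p) / N"
      using N by (auto simp: inner_2 field_simps)
    thus "vector [2*(a$1/N), 2*(a$2/N)] \<bullet> p = 2*c/N \<longleftrightarrow> a \<bullet> p = c"
      "vector [2*(a$1/N), 2*(a$2/N)] \<bullet> p > 2*c/N \<longleftrightarrow> a \<bullet> p > c"
      "vector [2*(-a$1/N), 2*(-a$2/N)] \<bullet> p = -2*c/N \<longleftrightarrow> a \<bullet> p = c"
      "vector [2*(-a$1/N), 2*(-a$2/N)] \<bullet> p > -2*c/N \<longleftrightarrow> a \<bullet> p < c"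
      using N by (simp_all add: divide_less_cancel)
  qed
  have "a$1/N * (a$1/N) + a$2/N * (a$2/N) = ((a$1)\<^sup>2 + (a$2)\<^sup>2) / N\<^sup>2"
    by (simp add: power2_eq_square add_divide_distrib)
  hence "a$1/N * (a$1/N) + a$2/N * (a$2/N) = 1"
    unfolding N2[symmetric] using N by simp
  hence u: "lorentz (0, a$1/N, a$2/N, 2*c/N) (0, a$1/N, a$2/N, 2*c/N) = 1"
    "lorentz (0, -a$1/N, -a$2/N, -2*c/N) (0, -a$1/N, -a$2/N, -2*c/N) = 1" by auto
  have "snd C = {p. a \<bullet> p < c} \<or> snd C = {p. a \<bullet> p > c}"
    using assms components_hyperplane[OF a(1), of c] unfolding is_circle_def a(2) by auto
  hence "C = circ_of (0, -a$1/N, -a$2/N, -2*c/N) \<or> C = circ_of (0, a$1/N, a$2/N, 2*c/N)"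
    unfolding circ_of_line eq using a(2) by (metis prod.collapse)
  thus ?thesis using u that by blast
next
  case False
  then obtain z r where r: "0 < r" "fst C = sphere z r" and "snd C \<in> components (- fst C)"
    using assms by (auto simp: is_circle_def)
  hence s: "snd C = ball z r \<or> snd C = - cball z r" using components_sphere[OF r(1)] by auto
  define e where "e = ((z$1)\<^sup>2 + (z$2)\<^sup>2 - r\<^sup>2) / r"
  have u: "lorentz (1/r, z$1/r, z$2/r, e) (1/r, z$1/r, z$2/r, e) = 1"
    "lorentz (-1/r, -z$1/r, -z$2/r, -e) (-1/r, -z$1/r, -z$2/r, -e) = 1"
    using r by (auto simp: e_def field_simps power2_eq_square)
  have z: "vector [z$1, z$2] = z" by (simp add: vec_eq_iff forall_2)
  have "circ_of (1/r, z$1/r, z$2/r, e) = (sphere z r, ball z r)"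
    using circ_of_pos[OF u(1)] r z by simp
  moreover have "circ_of (-1/r, -z$1/r, -z$2/r, -e) = (sphere z r, - cball z r)"
    using circ_of_neg[OF u(2)] r z by simp
  ultimately show ?thesis using u that s r(2) by (metis prod.collapse)
qed

lemma horocircle_eq_circ_of:
  assumes "0 < k"
  shows "horocircle t k = circ_of (k, k * t, 1, k * t\<^sup>2)"
  using circ_of_pos[of k "k*t" 1 "k*t\<^sup>2"] assms by (simp add: horocircle_def power2_eq_square)

lemma axis_circle_eq_circ_of: "axis_circle = circ_of (0, 0, -1, 0)"
  by (auto simp: axis_circle_def circ_of_def x_axis_def)

text \<open>Lets the Lorentz product be read off from a horocircle. Its bounded interior excludes
  negative curvature; then centre, radius and norm one leave a single vector.\<close>

lemma circ_of_eq_horocircle: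
  assumes n: "lorentz v v = 1" and k: "0 < k" and eq: "circ_of v = horocircle t k"
  shows "v = (k, k * t, 1, k * t\<^sup>2)"
proof -
  obtain b x y e where v: "v = (b, x, y, e)" by (cases v)
  note n' = n[unfolded v]
  have h: "horocircle t k = (sphere (vector [t, 1/k]) (1/k), ball (vector [t, 1/k]) (1/k))"
    by (simp add: horocircle_def)
  have "\<not> is_line (fst (circ_of v))" using not_is_line_sphere[of "1/k"] k eq h by simp
  hence "b \<noteq> 0" using is_line_circ_of[OF n'] v by simp
  moreover have "\<not> b < 0"
  proof
    assume b: "b < 0"
    have "bounded (- cball (vector [x/b, y/b] :: real^2) (-1/b))"
      using circ_of_neg[OF n' b] eq h v by (metis bounded_ball snd_conv)
    hence "bounded (UNIV :: (real^2) set)"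
      by (metis Compl_partition2 bounded_Un bounded_cball)
    thus False by simp
  qed
  ultimately have b: "b > 0" by simp
  have "ball (vector [x/b, y/b] :: real^2) (1/b) = ball (vector [t, 1/k]) (1/k)"
    using circ_of_pos[OF n' b] eq h v by simp
  hence "vector [x/b, y/b] = (vector [t, 1/k] :: real^2)" "1/b = 1/k"
    using b k unfolding ball_eq_ball_iff by auto
  hence "b = k" "x = k * t" "y = 1" using k by (auto simp: vec_eq_iff forall_2 field_simps)
  moreover have "e = k * t\<^sup>2" using n' k calculation by (simp add: power2_eq_square algebra_simps)
  ultimately show ?thesis using v by simp
qed

text \<open>At a common point the vectors (g1, g2) and (h1, h2) below are unit normals of the two
  curves, and the Lorentz product is their inner product. If they were not parallel, the curves
  would meet in a second point. Two lines are treated separately, since their tangency means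
  disjointness.\<close>

lemma tangent_lor:
  assumes n: "lorentz u u = 1" "lorentz v v = 1" and t: "tangent (circ_of u) (circ_of v)"
  shows "lorentz u v = 1 \<or> lorentz u v = -1"
proof -
  obtain b x y e where u: "u = (b, x, y, e)" by (cases u)
  obtain b' x' y' e' where v: "v = (b', x', y', e')" by (cases v)
  note n' = n[unfolded u v]
  have "(lorentz u v)\<^sup>2 = 1"
  proof (cases "b = 0 \<and> b' = 0")
    case True
    hence d: "fst (circ_of u) \<inter> fst (circ_of v) = {}"
      using t is_line_circ_of[OF n'(1)] is_line_circ_of[OF n'(2)] unfolding tangent_def u v by auto
    define D where "D = x * y' - x' * y"
    have "D = 0"
    proof (rule ccontr)
      assume D: "D \<noteq> 0"
      \<comment> \<open>Cramer's rule for the intersection point of two non-parallel lines.\<close>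
      define p :: "real^2" where "p = vector [(e*y' - e'*y) / (2*D), (e'*x - e*x') / (2*D)]"
      have "2 * (x * p$1 + y * p$2) = e" "2 * (x' * p$1 + y' * p$2) = e'"
        using D by (auto simp: p_def D_def divide_simps) algebra+
      hence "p \<in> fst (circ_of u) \<inter> fst (circ_of v)"
        using True by (simp add: circ_of_def u v)
      thus False using d by simp
    qed
    thus ?thesis using n' True unfolding u v D_def by simp algebra
  next
    case False
    then obtain p where p: "fst (circ_of u) \<inter> fst (circ_of v) = {p}"
      using t is_line_circ_of[OF n'(1)] is_line_circ_of[OF n'(2)] unfolding tangent_def u v by auto
    define g1 g2 h1 h2 where g: "g1 = b * p$1 - x" "g2 = b * p$2 - y"
      "h1 = b' * p$1 - x'" "h2 = b' * p$2 - y'"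
    have "circ_fun u p = 0" "circ_fun v p = 0" using p by (auto simp: circ_of_def)
    hence l: "b * ((p$1)\<^sup>2 + (p$2)\<^sup>2) - 2 * x * p$1 - 2 * y * p$2 + e = 0"
      "b' * ((p$1)\<^sup>2 + (p$2)\<^sup>2) - 2 * x' * p$1 - 2 * y' * p$2 + e' = 0"
      unfolding u v by auto
    have nn: "x*x+y*y - b*e = 1" "x'*x'+y'*y'-b'*e' = 1" using n' by auto
    have G: "g1\<^sup>2 + g2\<^sup>2 = 1" "h1\<^sup>2 + h2\<^sup>2 = 1" using l nn unfolding g by algebra+
    have "2 * (g1 * h1 + g2 * h2) = 2 * (x * x' + y * y') - (b * e' + b' * e)"
      using l unfolding g by algebra
    hence L: "lorentz u v = g1 * h1 + g2 * h2" unfolding u v by (simp add: field_simps)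
    define \<kappa> where "\<kappa> = g1 * h2 - g2 * h1"
    have "\<kappa> = 0"
    proof (rule ccontr)
      assume \<kappa>: "\<kappa> \<noteq> 0"
      \<comment> \<open>Here \<open>p\<close> cancels: the vector is b' (x, y) - b (x', y'), a
        direction of the line of centres, or the normal when one of the curves is a line.\<close>
      define r1 r2 where r: "r1 = b * h1 - b' * g1" "r2 = b * h2 - b' * g2"
      have "\<not> (r1 = 0 \<and> r2 = 0)"
      proof
        assume "r1 = 0 \<and> r2 = 0"
        hence "b * \<kappa> = 0" "b' * \<kappa> = 0" unfolding r \<kappa>_def by algebra+
        thus False using \<kappa> False by auto
      qed
      hence R: "r1\<^sup>2 + r2\<^sup>2 > 0" by (simp add: sum_power2_gt_zero_iff)
      define s where "s = 2 * \<kappa> / (r1\<^sup>2 + r2\<^sup>2)"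
      have s: "s * (r1\<^sup>2 + r2\<^sup>2) = 2 * \<kappa>" unfolding s_def using R by (metis less_irrefl nonzero_eq_divide_eq)
      have c: "g1 * r2 - g2 * r1 = b * \<kappa>" "h1 * r2 - h2 * r1 = b' * \<kappa>" unfolding r \<kappa>_def by algebra+
      \<comment> \<open>the reflection of \<open>p\<close> in the line of centres is a second common point\<close>
      define q :: "real^2" where "q = vector [p$1 - s * r2, p$2 + s * r1]"
      have a1: "circ_fun u q = circ_fun u p + s * (b * (s * (r1\<^sup>2 + r2\<^sup>2)) - 2 * (g1 * r2 - g2 * r1))"
        unfolding u q_def circ_fun.simps vector_2 g by algebra
      have a2: "circ_fun v q = circ_fun v p + s * (b' * (s * (r1\<^sup>2 + r2\<^sup>2)) - 2 * (h1 * r2 - h2 * r1))"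
        unfolding v q_def circ_fun.simps vector_2 g by algebra
      have "circ_fun u q = 0" "circ_fun v q = 0"
        using \<open>circ_fun u p = 0\<close> \<open>circ_fun v p = 0\<close> unfolding a1 a2 s c by auto
      hence "q = p" using p by (auto simp: circ_of_def)
      hence "s * r2 = 0" "s * r1 = 0" by (auto simp: q_def vec_eq_iff forall_2)
      hence "s * (r1\<^sup>2 + r2\<^sup>2) = 0" by algebra
      thus False using s \<kappa> by simp
    qed
    thus ?thesis using G unfolding L \<kappa>_def by algebra
  qed
  thus ?thesis by (simp add: power2_eq_1_iff)
qed

text \<open>If the product were 1, then u - v would be a null vector, so the difference of the two
  functions would have constant sign. One interior would then contain the other, and neither is
  empty.\<close>

lemma tangent_disjoint_lor:
  assumes n: "lorentz u u = 1" "lorentz v v = 1" and t: "tangent (circ_of u) (circ_of v)"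
    and d: "snd (circ_of u) \<inter> snd (circ_of v) = {}"
  shows "lorentz u v = -1"
proof (rule ccontr)
  assume "lorentz u v \<noteq> -1"
  hence 1: "lorentz u v = 1" using tangent_lor[OF n t] by simp
  obtain b x y e where u: "u = (b, x, y, e)" by (cases u)
  obtain b' x' y' e' where v: "v = (b', x', y', e')" by (cases v)
  define c where "c = b - b'"
  have null: "(x - x')\<^sup>2 + (y - y')\<^sup>2 = c * (e - e')"
    using n 1 unfolding u v c_def by (simp add: field_simps power2_eq_square)
  have sq: "c * (circ_fun u p - circ_fun v p) = (c * p$1 - (x - x'))\<^sup>2 + (c * p$2 - (y - y'))\<^sup>2" for p
    using null unfolding u v c_def circ_fun.simps by algebra
  have "(\<forall>p. circ_fun u p \<le> circ_fun v p) \<or> (\<forall>p. circ_fun v p \<le> circ_fun u p)"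
  proof (cases "c = 0")
    case True
    hence "x = x'" "y = y'" "b = b'" using null by (auto simp: sum_power2_eq_zero_iff c_def)
    thus ?thesis unfolding u v by auto
  next
    case False
    have "c * (circ_fun u p - circ_fun v p) \<ge> 0" for p unfolding sq by simp
    thus ?thesis using False by (cases "c > 0") (auto simp: zero_le_mult_iff)
  qed
  hence "snd (circ_of v) \<subseteq> snd (circ_of u) \<or> snd (circ_of u) \<subseteq> snd (circ_of v)"
    unfolding circ_of_def snd_conv by (rule disj_forward) (auto intro: le_less_trans)
  moreover have "snd (circ_of u) \<noteq> {}" "snd (circ_of v) \<noteq> {}"
    using is_circle_circ_of n in_components_nonempty unfolding is_circle_def by blast+
  ultimately show False using d by auto
qed

text \<open>Product -1 makes u + v a null vector, so the sum of the two functions has constant sign.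
  The hypothesis \<open>pos\<close> makes this sign nonnegative; it is needed because -u and -v have
  the same product but the opposite interiors.\<close>

lemma lor_tangent_disjoint:
  assumes n: "lorentz (b, x, y, e) (b, x, y, e) = 1" "lorentz (b', x', y', e') (b', x', y', e') = 1"
    and l: "lorentz (b, x, y, e) (b', x', y', e') = -1"
    and pos: "b + b' > 0 \<or> b = 0 \<and> b' = 0 \<and> e + e' > 0"
  shows "tangent (circ_of (b, x, y, e)) (circ_of (b', x', y', e'))"
    and "snd (circ_of (b, x, y, e)) \<inter> snd (circ_of (b', x', y', e')) = {}"
proof -
  let ?u = "(b, x, y, e)" and ?v = "(b', x', y', e')"
  define c where "c = b + b'"
  have null: "(x + x')\<^sup>2 + (y + y')\<^sup>2 = c * (e + e')"
    using n l unfolding c_def by (simp add: field_simps power2_eq_square)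
  have sq: "c * (circ_fun ?u p + circ_fun ?v p) = (c * p$1 - (x + x'))\<^sup>2 + (c * p$2 - (y + y'))\<^sup>2" for p
    using null unfolding c_def circ_fun.simps by algebra
  have ge: "circ_fun ?u p + circ_fun ?v p \<ge> 0" for p
  proof (cases "c > 0")
    case True
    have "c * (circ_fun ?u p + circ_fun ?v p) \<ge> 0" unfolding sq by simp
    thus ?thesis using True by (simp add: zero_le_mult_iff del: circ_fun.simps)
  next
    case False
    hence "b = 0" "b' = 0" "e + e' > 0" using pos by (auto simp: c_def)
    moreover have "x + x' = 0" "y + y' = 0" using null calculation by (auto simp: sum_power2_eq_zero_iff c_def)
    hence "x' = - x" "y' = - y" by auto
    ultimately show ?thesis by simp
  qed
  show "snd (circ_of ?u) \<inter> snd (circ_of ?v) = {}"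
    using ge by (auto simp: circ_of_def simp del: circ_fun.simps) (smt (verit))
  show "tangent (circ_of ?u) (circ_of ?v)"
  proof (cases "c > 0")
    case True
    \<comment> \<open>The sum of the two functions is \<open>c\<close> times the squared distance to
      this point, which is therefore the only candidate for a common zero.\<close>
    define p0 :: "real^2" where "p0 = vector [(x + x')/c, (y + y')/c]"
    have p0: "c * p0$1 = x + x'" "c * p0$2 = y + y'" using True by (auto simp: p0_def)
    have un: "p = p0" if "circ_fun ?u p = 0" "circ_fun ?v p = 0" for p
    proof -
      have "c * p$1 = x + x'" "c * p$2 = y + y'" using sq[of p] that by (auto simp: sum_power2_eq_zero_iff simp del: circ_fun.simps)
      hence "c * p$1 = c * p0$1" "c * p$2 = c * p0$2" unfolding p0 .
      thus ?thesis using True by (simp add: vec_eq_iff forall_2)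
    qed
    have "c * (circ_fun ?u p0 + circ_fun ?v p0) = 0" unfolding sq p0 by simp
    hence s0: "circ_fun ?u p0 + circ_fun ?v p0 = 0" using True by (simp del: circ_fun.simps)
    \<comment> \<open>At \<open>p0\<close> only the sum is known to vanish so far; that each summand
      does follows from the relations for norm and product.\<close>
    have "c\<^sup>2 * circ_fun ?u p0 = 0"
    proof -
      have "c\<^sup>2 * circ_fun ?u p0 = b * ((c * p0$1)\<^sup>2 + (c * p0$2)\<^sup>2) - 2*c*(x * (c * p0$1) + y * (c * p0$2)) + c\<^sup>2 * e"
        by (simp add: algebra_simps power2_eq_square)
      also have "\<dots> = b * ((x + x')\<^sup>2 + (y + y')\<^sup>2) - 2*c*(x * (x + x') + y * (y + y')) + c\<^sup>2 * e"
        unfolding p0 ..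
      also have "\<dots> = c * (b * (e + e') - 2 * (x * (x + x') + y * (y + y')) + c * e)"
        unfolding null by (simp add: algebra_simps power2_eq_square)
      also have "b * (e + e') - 2 * (x * (x + x') + y * (y + y')) + c * e = 0"
        using n(1) l unfolding c_def by (simp add: field_simps)
      finally show ?thesis by simp
    qed
    hence "circ_fun ?u p0 = 0" using True by (simp del: circ_fun.simps)
    hence "circ_fun ?u p = 0 \<and> circ_fun ?v p = 0 \<longleftrightarrow> p = p0" for p
      using un[of p] s0 by (metis add.left_neutral)
    hence "fst (circ_of ?u) \<inter> fst (circ_of ?v) = {p0}"
      unfolding circ_of_def fst_conv by blast
    moreover have "\<not> (b = 0 \<and> b' = 0)" using True by (auto simp: c_def)
    ultimately show ?thesis unfolding tangent_def using is_line_circ_of[OF n(1)] is_line_circ_of[OF n(2)] by auto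
  next
    case False
    hence z: "b = 0" "b' = 0" "e + e' > 0" using pos by (auto simp: c_def)
    moreover have "x + x' = 0" "y + y' = 0" using null z by (auto simp: sum_power2_eq_zero_iff c_def)
    hence xy: "x' = - x" "y' = - y" by auto
    ultimately have "fst (circ_of ?u) \<inter> fst (circ_of ?v) = {}" by (auto simp: circ_of_def)
    thus ?thesis unfolding tangent_def using is_line_circ_of[OF n(1)] is_line_circ_of[OF n(2)] z by auto
  qed
qed


section \<open>Descartes quadruples\<close>

lemma lor_commute: "lorentz u v = lorentz v u"
  by (cases u; cases v) simp

lemma linear_lor: "linear (lorentz u)"
  by (rule linearI; cases u) (auto simp: algebra_simps add_divide_distrib split: prod.splits)

type_synonym 'a quad = "4 \<Rightarrow> 'a"

text \<open>The reflection behind Descartes' theorem: it exchanges the two circles tangent to the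
  other three. It is stated for every real vector space so that a linear functional can be pushed
  through it and the real values themselves be swapped.\<close>

definition swap :: "4 \<Rightarrow> 'a::real_vector quad \<Rightarrow> 'a quad" where
  "swap k p = p(k := 2 *\<^sub>R (\<Sum>i\<in>UNIV - {k}. p i) - p k)"

lemma swap_swap [simp]: "swap k (swap k p) = p"
  by (auto simp: swap_def fun_eq_iff intro!: sum.cong)

lemma swap_apply: "swap k p i = (if i = k then 2 *\<^sub>R (\<Sum>i\<in>UNIV - {k}. p i) - p k else p i)"
  by (simp add: swap_def)

lemma linear_swap: "linear f \<Longrightarrow> f (swap k p i) = swap k (\<lambda>i. f (p i)) i"
  by (simp add: swap_def linear_diff linear_scale linear_sum)

text \<open>The Gram matrix is invertible, so the four vectors are independent; the second conjunct
  expresses that they span, in the form used to recover a vector from its four products.\<close>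

definition descartes :: "lvec quad \<Rightarrow> bool" where
  "descartes p \<longleftrightarrow> (\<forall>i j. lorentz (p i) (p j) = (if i = j then 1 else - 1)) \<and>
     (\<forall>v. (\<forall>i. lorentz v (p i) = 0) \<longrightarrow> v = 0)"

lemma sum_signs_4: "(\<Sum>i\<in>UNIV - {k}. if i = j then - 1 else 1 :: real) = (if j = k then 3 else 1)" for j k :: 4
proof -
  have "(\<Sum>i\<in>UNIV - {k}. if i = j then - 1 else 1 :: real)
      = (\<Sum>i\<in>UNIV - {k}. 1 - (if i = j then 2 else 0))"
    by (rule sum.cong) auto
  thus ?thesis by (simp add: sum_subtractf card_Diff_singleton)
qed

text \<open>Swapping the index with value -1 gives 2 * 3 + 1 = 7, any other index gives 2 * 1 - 1 =
  1. The 7 is where the growth in \<open>red_values\<close> starts.\<close>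

lemma swap_signs:
  fixes j k :: 4
  shows "swap k (\<lambda>i. if i = j then - 1 else 1 :: real) = (if j = k then (\<lambda>i. if i = j then 7 else 1) else (\<lambda>i. if i = j then - 1 else 1))"
  by (auto simp: swap_apply sum_signs_4 fun_eq_iff)

lemma swap_signs':
  fixes j k :: 4
  shows "swap k (\<lambda>i. if i = j then 1 else - 1 :: real) = (if j = k then (\<lambda>i. if i = j then - 7 else - 1) else (\<lambda>i. if i = j then 1 else - 1))"
proof
  fix l
  have "swap k (\<lambda>i. - f i) l = - swap k f l" for f :: "4 \<Rightarrow> real"
    by (simp add: swap_apply sum_negf)
  hence "swap k (\<lambda>i. - (if i = j then - 1 else 1)) l = - swap k (\<lambda>i. if i = j then - 1 else 1 :: real) l" .
  moreover have "(\<lambda>i. - (if i = j then - 1 else 1)) = (\<lambda>i. if i = j then 1 else - 1 :: real)" by auto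
  ultimately show "swap k (\<lambda>i. if i = j then 1 else - 1 :: real) l = (if j = k then (\<lambda>i. if i = j then - 7 else - 1) else (\<lambda>i. if i = j then 1 else - 1)) l"
    by (simp add: swap_signs)
qed

text \<open>The swap is pushed through one argument of the form at a time; the second conjunct is
  carried back because a swap is an involution.\<close>

lemma descartes_swap:
  assumes "descartes p"
  shows "descartes (swap k p)"
proof -
  have g: "lorentz (p i) (p j) = (if i = j then 1 else - 1)" for i j
    using assms by (simp add: descartes_def)
  have row: "lorentz (p i) (swap k p j) = (if i = k \<and> j = k then - 7 else if i = j then 1 else - 1)" for i j
  proof -
    have "lorentz (p i) (swap k p j) = swap k (\<lambda>j. if j = i then 1 else - 1) j"
      by (subst linear_swap[OF linear_lor]) (simp add: g eq_commute[of i])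
    thus ?thesis by (auto simp: swap_signs')
  qed
  have "lorentz (swap k p i) (swap k p j) = (if i = j then 1 else - 1)" for i j
  proof -
    have "lorentz (swap k p j) (swap k p i) = swap k (\<lambda>i. lorentz (p i) (swap k p j)) i"
      by (subst linear_swap[OF linear_lor]) (simp add: lor_commute)
    also have "(\<lambda>i. lorentz (p i) (swap k p j)) = (\<lambda>i. if i = k \<and> j = k then - 7 else if i = j then 1 else - 1)"
      by (simp only: row)
    also have "swap k \<dots> i = (if i = j then 1 else - 1)"
    proof (cases "j = k")
      case True
      have "(\<Sum>i\<in>UNIV - {k}. if i = k then - 7 else if i = k then 1 else - 1 :: real) = (\<Sum>i\<in>UNIV - {k}. - 1)"
        by (rule sum.cong) auto
      thus ?thesis using True by (auto simp: swap_apply card_Diff_singleton)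
    next
      case False
      thus ?thesis by (simp add: swap_signs')
    qed
    finally show ?thesis by (simp add: lor_commute)
  qed
  moreover have "v = 0" if v: "\<And>i. lorentz v (swap k p i) = 0" for v
  proof -
    have "lorentz v (p i) = 0" for i
    proof -
      have "lorentz v (swap k (swap k p) i) = swap k (\<lambda>i. lorentz v (swap k p i)) i"
        by (rule linear_swap[OF linear_lor])
      thus ?thesis unfolding v swap_swap by (simp add: swap_apply)
    qed
    thus ?thesis using assms unfolding descartes_def by blast
  qed
  ultimately show ?thesis unfolding descartes_def by blast
qed

text \<open>Only the product \<open>t\<close> with \<open>p k\<close> is free, and it determines
  \<open>v\<close>. Norm one then becomes a quadratic equation for \<open>t\<close> with the roots 1
  and -7, one for each of the two circles.\<close>

lemma descartes_fourth:
  assumes p: "descartes p" and v: "lorentz v v = 1" "\<And>i. i \<noteq> k \<Longrightarrow> lorentz v (p i) = - 1"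
  shows "v = p k \<or> v = swap k p k"
proof -
  define t where "t = lorentz v (p k)"
  define S where "S = (\<Sum>i\<in>UNIV - {k}. p i)"
  \<comment> \<open>the inverse of the Gram matrix is a quarter of it, which gives the coordinates of \<open>v\<close>\<close>
  define c where "c = ((1 - t) / 4) *\<^sub>R S + ((3 + t) / 4) *\<^sub>R p k"
  have g: "lorentz (p i) (p j) = (if i = j then 1 else - 1)" for i j
    using p by (simp add: descartes_def)
  have S: "lorentz w S = (\<Sum>i\<in>UNIV - {k}. lorentz w (p i))" for w
    unfolding S_def by (rule linear_sum[OF linear_lor])
  have lc: "lorentz w c = (1 - t) / 4 * lorentz w S + (3 + t) / 4 * lorentz w (p k)" for w
    unfolding c_def by (simp add: linear_add[OF linear_lor] linear_scale[OF linear_lor])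
  have pS: "lorentz (p i) S = (if i = k then - 3 else - 1)" for i
  proof -
    have "lorentz (p i) S = (\<Sum>j\<in>UNIV - {k}. - (if j = i then - 1 else 1))"
      unfolding S g by (rule sum.cong) auto
    thus ?thesis by (simp add: sum_negf sum_signs_4)
  qed
  have vS: "lorentz v S = - 3"
    unfolding S by (subst sum.cong[OF refl, of _ _ "\<lambda>_. - 1"]) (auto simp: v card_Diff_singleton)
  have "lorentz (v - c) (p i) = 0" for i
  proof -
    have "lorentz (p i) (v - c) = lorentz v (p i) - lorentz (p i) c"
      by (simp add: linear_diff[OF linear_lor] lor_commute)
    also have "\<dots> = 0"
      unfolding lc pS g using v(2)[of i] by (cases "i = k") (auto simp: t_def field_simps)
    finally show ?thesis by (simp add: lor_commute)
  qed
  hence "v - c = 0" using p unfolding descartes_def by blast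
  hence vc: "v = c" by simp
  have "1 = (1 - t) / 4 * - 3 + (3 + t) / 4 * t"
    using v(1) lc[of v] unfolding vc[symmetric] vS t_def by simp
  hence "(t - 1) * (t + 7) = 0" by algebra
  hence "t = 1 \<or> t = - 7" by auto
  moreover have "c = p k" if "t = 1" using that by (simp add: c_def)
  moreover have "c = swap k p k" if "t = - 7" using that by (simp add: c_def swap_apply S_def)
  ultimately show ?thesis using vc by blast
qed

section \<open>Orbits under swaps, reduced words and the growth of the form along them\<close>

inductive reach :: "'a::real_vector quad \<Rightarrow> 'a quad \<Rightarrow> bool" for q where
  refl: "reach q q"
| step: "reach q p \<Longrightarrow> reach q (swap k p)"

lemma reach_trans: "reach p r \<Longrightarrow> reach q p \<Longrightarrow> reach q r"
  by (induction rule: reach.induct) (auto intro: reach.step)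

lemma reach_sym: "reach q p \<Longrightarrow> reach p q"
proof (induction rule: reach.induct)
  case (step p k)
  have "reach (swap k p) p" using reach.step[OF reach.refl, of "swap k p" k] by simp
  thus ?case using step.IH reach_trans by blast
qed (rule reach.refl)

lemma descartes_reach: "reach q p \<Longrightarrow> descartes q \<Longrightarrow> descartes p"
  by (induction rule: reach.induct) (auto intro: descartes_swap)

text \<open>Reduced words: no index is swapped twice in a row; \<open>l\<close> is the index swapped last and \<open>J\<close>
  the set of all indices swapped.\<close>

inductive reduced :: "'a::real_vector quad \<Rightarrow> 'a quad \<Rightarrow> 4 option \<Rightarrow> 4 set \<Rightarrow> bool" for q where
  refl: "reduced q q None {}"
| step: "reduced q p l J \<Longrightarrow> l \<noteq> Some k \<Longrightarrow> reduced q (swap k p) (Some k) (insert k J)"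

lemma red_imp_reach: "reduced q p l J \<Longrightarrow> reach q p"
  by (induction rule: reduced.induct) (auto intro: reach.intros)

text \<open>A swap that repeats the last one cancels it, since swaps are involutions.\<close>

lemma reach_imp_red: "reach q p \<Longrightarrow> \<exists>l J. reduced q p l J"
proof (induction rule: reach.induct)
  case (step p k)
  then obtain l J where r: "reduced q p l J" by blast
  show ?case
  proof (cases "l = Some k")
    case True
    from r obtain p' l' J' where "p = swap k p'" "reduced q p' l' J'"
      by cases (use True in auto)
    thus ?thesis by auto
  qed (use r reduced.step in blast)
qed (blast intro: reduced.refl)

text \<open>Cut the word off after its last swap of \<open>i\<close>: later swaps do not touch the
  entry at \<open>i\<close>. If \<open>i\<close> is never swapped, the empty word serves.\<close>

lemma red_newest:
  assumes "reach q p"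
  obtains p' l J where "reduced q p' l J" "p' i = p i" "l = None \<and> J = {} \<or> l = Some i"
proof -
  obtain l J where "reduced q p l J" using reach_imp_red[OF assms] by blast
  hence "\<exists>p' l J. reduced q p' l J \<and> p' i = p i \<and> (l = None \<and> J = {} \<or> l = Some i)"
  proof (induction rule: reduced.induct)
    case refl
    show ?case using reduced.refl by blast
  next
    case (step p l J k)
    show ?case
    proof (cases "k = i")
      case True
      thus ?thesis using reduced.step[OF step.hyps] by blast
    next
      case False
      thus ?thesis using step.IH by (simp add: swap_apply)
    qed
  qed
  thus ?thesis using that by blast
qed

text \<open>Swaps of other indices preserve the initial values. The first swap of \<open>j\<close>
  creates the value 7, and from then on the entry swapped last is the largest, because in a reduced
  word the next swap is at a different index.\<close>

lemma red_values:
  fixes f :: "'a::real_vector \<Rightarrow> real"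
  assumes "reduced q p l J" "linear f" "\<And>i. f (q i) = (if i = j then - 1 else 1)"
  shows "(j \<notin> J \<longrightarrow> p j = q j \<and> (\<forall>i. f (p i) = (if i = j then - 1 else 1))) \<and>
    (j \<in> J \<longrightarrow> (\<exists>k. l = Some k \<and> 7 \<le> f (p k) \<and> (\<forall>i. 1 \<le> f (p i) \<and> f (p i) \<le> f (p k))))"
  using assms(1)
proof (induction rule: reduced.induct)
  case refl
  show ?case using assms(3) by simp
next
  case (step p l J k)
  have fs: "f (swap k p i) = swap k (\<lambda>i. f (p i)) i" for i by (rule linear_swap[OF assms(2)])
  show ?case
  proof (cases "j \<in> J")
    case False
    hence p: "p j = q j" "(\<lambda>i. f (p i)) = (\<lambda>i. if i = j then - 1 else 1)" using step.IH by auto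
    show ?thesis unfolding fs p(2) swap_signs using p(1) False by (auto simp: swap_apply)
  next
    case True
    then obtain m where m: "l = Some m" "7 \<le> f (p m)" "\<And>i. 1 \<le> f (p i)" "\<And>i. f (p i) \<le> f (p m)"
      using step.IH by auto
    have mk: "m \<noteq> k" using step.hyps m by auto
    \<comment> \<open>The largest value is among the summands as m \<noteq> k, and the others are
      positive, so the new value is at least 2 f (p m) - f (p k) \<ge> f (p m).\<close>
    have "(\<Sum>i\<in>UNIV - {k}. f (p i)) = f (p m) + (\<Sum>i\<in>UNIV - {k} - {m}. f (p i))"
      using mk by (intro sum.remove) auto
    moreover have "0 \<le> (\<Sum>i\<in>UNIV - {k} - {m}. f (p i))"
      by (rule sum_nonneg) (use m(3) in \<open>smt (verit)\<close>)
    ultimately have "f (swap k p k) \<ge> f (p m)" using m(4)[of k]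
      unfolding fs by (simp add: swap_apply)
    hence "7 \<le> f (swap k p k)" "1 \<le> f (swap k p i)" "f (swap k p i) \<le> f (swap k p k)" for i
      using m(2) m(3)[of i] m(4)[of i] by (auto simp: swap_apply)
    thus ?thesis using True by simp
  qed
qed

lemma red_fixed: "reduced q p l J \<Longrightarrow> j \<notin> J \<Longrightarrow> p j = q j"
  by (induction rule: reduced.induct) (auto simp: swap_apply)

text \<open>The orbit may be rooted at \<open>p\<close> itself. There minus the product with
  \<open>p a\<close> has the values -1 at \<open>a\<close> and 1 elsewhere, so
  \<open>red_values\<close> applies.\<close>

lemma lor_reach:
  assumes q: "descartes q" and "reach q p" "reach q r"
  shows "p a = r b \<or> lorentz (p a) (r b) \<le> - 1"
proof -
  have p: "descartes p" using descartes_reach[OF assms(2) q] .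
  have "reach p r" using reach_trans[OF assms(3) reach_sym[OF assms(2)]] .
  then obtain l J where r: "reduced p r l J" using reach_imp_red by blast
  have "linear (\<lambda>v. - lorentz (p a) v)" using linear_lor linear_compose_neg by blast
  note V = red_values[OF r this, of a]
  show ?thesis
  proof (cases "a \<in> J")
    case True
    thus ?thesis using V p by (force simp: descartes_def)
  next
    case False
    thus ?thesis using V p by (auto simp: descartes_def split: if_splits) (smt (verit))
  qed
qed

text \<open>Take a word in which \<open>b\<close> is swapped last. If it also swapped
  \<open>a\<close>, the product at the newest circle would be at most -7.\<close>

lemma red_tangent:
  assumes p: "descartes p" and "reach p r" "lorentz (p a) (r b) = - 1"
  obtains r' l J where "reduced p r' l J" "r' b = r b" "a \<notin> J" "l = None \<and> J = {} \<or> l = Some b"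
proof -
  obtain r' l J where r: "reduced p r' l J" "r' b = r b" "l = None \<and> J = {} \<or> l = Some b"
    using red_newest[OF assms(2)] by metis
  have "linear (\<lambda>v. - lorentz (p a) v)" using linear_lor linear_compose_neg by blast
  note V = red_values[OF r(1) this, of a]
  have "a \<notin> J"
  proof
    assume "a \<in> J"
    hence "7 \<le> - lorentz (p a) (r b)" using V p r by (auto simp: descartes_def)
    thus False using assms by simp
  qed
  thus ?thesis using that r by blast
qed

text \<open>First move from a quadruple of A to one that contains A and B, then from there to one
  that contains C. The second word avoids the index of A, and since its newest circle C is tangent
  to B, it avoids the index of B as well.\<close>

lemma tangent_triple_in_quad:
  assumes q: "descartes q"
    and A: "reach q p1" "A = p1 a" and B: "reach q p2" "B = p2 b" and C: "reach q p3" "C = p3 c"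
    and l: "lorentz A B = - 1" "lorentz A C = - 1" "lorentz B C = - 1"
  shows "\<exists>p. reach q p \<and> A = p a \<and> B = p b \<and> C = p c"
proof -
  have d1: "descartes p1" using descartes_reach[OF A(1) q] .
  have "reach p1 p2" using reach_trans[OF B(1) reach_sym[OF A(1)]] .
  then obtain p l J where p: "reduced p1 p l J" "p b = p2 b" "a \<notin> J"
    using red_tangent[OF d1, of p2 a b] l A B by metis
  have pa: "p a = A" using red_fixed[OF p(1,3)] A by simp
  have rp: "reach q p" using reach_trans[OF red_imp_reach[OF p(1)] A(1)] .
  have d: "descartes p" using descartes_reach[OF rp q] .
  have "reach p p3" using reach_trans[OF C(1) reach_sym[OF rp]] .
  then obtain r l' J' where r: "reduced p r l' J'" "r c = p3 c" "a \<notin> J'"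
     "l' = None \<and> J' = {} \<or> l' = Some c"
    using red_tangent[OF d, of p3 a c] l pa C by metis
  have "linear (\<lambda>v. - lorentz (p b) v)" using linear_lor linear_compose_neg by blast
  note V = red_values[OF r(1) this, of b]
  have "b \<notin> J'"
  proof
    assume "b \<in> J'"
    hence "7 \<le> - lorentz (p b) (r c)" using V d r by (auto simp: descartes_def)
    thus False using l p r B C by simp
  qed
  hence "r a = A" "r b = B" "r c = C" using red_fixed[OF r(1)] r pa p B C by auto
  thus ?thesis using reach_trans[OF red_imp_reach[OF r(1)] rp] by blast
qed


section \<open>The circles of the packing tangent to the axis\<close>

lemma mono_packing_step: "P \<subseteq> Q \<Longrightarrow> packing_step P \<subseteq> packing_step Q"
  unfolding packing_step_def by blast

lemma funpow_packing_step_mono: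
  assumes "i \<le> j"
  shows "(packing_step ^^ i) P \<subseteq> (packing_step ^^ j) P"
  using assms by (induction j rule: dec_induct) (auto simp: packing_step_def)

lemma generated_packing_base: "P \<subseteq> generated_packing P"
proof -
  have "P = (packing_step ^^ 0) P" by simp
  thus ?thesis unfolding generated_packing_def by blast
qed

lemma packing_step_generated: "packing_step (generated_packing P) \<subseteq> generated_packing P"
proof
  fix D assume "D \<in> packing_step (generated_packing P)"
  then consider "D \<in> generated_packing P" |
    A B C where "is_circle D" "A \<in> generated_packing P" "B \<in> generated_packing P" "C \<in> generated_packing P"
      "mutually_tangent A B C" "\<forall>E\<in>{A, B, C}. tangent D E \<and> snd D \<inter> snd E = {}"
    unfolding packing_step_def by blast
  thus "D \<in> generated_packing P"
  proof cases
    case 2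
    then obtain i j k where "A \<in> (packing_step ^^ i) P" "B \<in> (packing_step ^^ j) P" "C \<in> (packing_step ^^ k) P"
      unfolding generated_packing_def by blast
    \<comment> \<open>Stages increase, so the three circles occur together at the latest of their
      stages.\<close>
    moreover define l where "l = max i (max j k)"
    ultimately have "A \<in> (packing_step ^^ l) P" "B \<in> (packing_step ^^ l) P" "C \<in> (packing_step ^^ l) P"
      using funpow_packing_step_mono[of i l P] funpow_packing_step_mono[of j l P]
        funpow_packing_step_mono[of k l P] by (auto simp: l_def le_max_iff_disj)
    hence "D \<in> packing_step ((packing_step ^^ l) P)"
      using 2 unfolding packing_step_def by blast
    hence "D \<in> (packing_step ^^ Suc l) P" by simp
    thus ?thesis unfolding generated_packing_def by blast
  qed
qed

lemma generated_packing_least: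
  assumes "P \<subseteq> Q" "packing_step Q \<subseteq> Q"
  shows "generated_packing P \<subseteq> Q"
proof -
  have "(packing_step ^^ n) P \<subseteq> Q" for n
  proof (induction n)
    case (Suc n)
    thus ?case using mono_packing_step[OF Suc] assms(2) by simp
  qed (use assms(1) in simp)
  thus ?thesis unfolding generated_packing_def by blast
qed

lemma packing_stepI:
  assumes "packing_step Q \<subseteq> Q" "is_circle D" "A \<in> Q" "B \<in> Q" "C \<in> Q"
    "tangent A B" "tangent B C" "tangent A C" "tangent D A" "tangent D B" "tangent D C"
    "snd D \<inter> snd A = {}" "snd D \<inter> snd B = {}" "snd D \<inter> snd C = {}"
  shows "D \<in> Q"
  using assms unfolding packing_step_def mutually_tangent_def by blast

lemma not_tangent_self:
  assumes "is_circle C"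
  shows "\<not> tangent C C"
proof (cases "is_line (fst C)")
  case True
  hence "fst C \<noteq> {}" by (auto simp: is_line_def)
  thus ?thesis using True by (simp add: tangent_def)
next
  case False
  then obtain z r where r: "0 < r" "fst C = sphere z r" using assms by (auto simp: is_circle_def)
  let ?e = "r *\<^sub>R axis 1 1 :: real^2"
  have "z + ?e \<in> fst C" "z - ?e \<in> fst C" using r by (auto simp: dist_norm)
  moreover have "z + ?e \<noteq> z - ?e" using r by (simp add: vec_eq_iff axis_def)
  ultimately have "\<nexists>p. fst C = {p}" by (metis singletonD)
  thus ?thesis using False by (simp add: tangent_def)
qed

section \<open>Ford circles of integer vectors\<close>

definition axis_vec :: lvec where
  "axis_vec = (0, 0, - 1, 0)"

text \<open>If \<open>m \<alpha> + n = 0\<close>, this is the half-plane above the line of height \<open>2 n\<^sup>2 / \<alpha>\<^sup>2\<close>.\<close>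

definition ford :: "real \<Rightarrow> int \<Rightarrow> int \<Rightarrow> lvec" where
  "ford \<alpha> m n = ((m * \<alpha> + n)\<^sup>2, 2 * n * (m * \<alpha> + n) / \<alpha>, 1, 4 * (real_of_int n)\<^sup>2 / \<alpha>\<^sup>2)"

text \<open>The vector (-1, -1) is taken instead of (1, 1), which has the same circle, so that the
  three integer vectors add up to zero. This is the invariant of
  \<open>ford_root_red\<close>.\<close>

definition ford_root :: "real \<Rightarrow> lvec quad" where
  "ford_root \<alpha> i = (if i = 1 then axis_vec else if i = 2 then ford \<alpha> 1 0 else if i = 3 then ford \<alpha> 0 1
     else ford \<alpha> (-1) (-1))"

lemma swap_apply_sum: "swap k p k = 2 *\<^sub>R (\<Sum>i\<in>UNIV. p i) - 3 *\<^sub>R p k"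
proof -
  have "(\<Sum>i\<in>UNIV. p i) = p k + (\<Sum>i\<in>UNIV - {k}. p i)" by (rule sum.remove) auto
  moreover have "3 *\<^sub>R p k = 2 *\<^sub>R p k + p k" by (simp add: scaleR_left_distrib[of 2 1 "p k", simplified])
  ultimately show ?thesis by (simp add: swap_apply algebra_simps)
qed

lemma ford_minus: "ford \<alpha> (- m) (- n) = ford \<alpha> m n"
  by (auto simp: ford_def power2_eq_square algebra_simps)

lemma lor_axis_ford: "lorentz axis_vec (ford \<alpha> m n) = - 1" "lorentz (ford \<alpha> m n) axis_vec = - 1"
  by (simp_all add: ford_def axis_vec_def)

lemma lor_axis: "lorentz axis_vec axis_vec = 1"
  by (simp add: axis_vec_def)

lemma coprime_diff_mult:
  fixes a c :: int
  assumes "coprime a c"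
  shows "coprime (a - s * c) c"
proof (rule coprimeI)
  fix d assume d: "d dvd a - s * c" "d dvd c"
  have "d dvd (a - s * c) + s * c" using d by (intro dvd_add dvd_mult)
  hence "d dvd a" by simp
  thus "is_unit d" using coprime_common_divisor[OF assms] d(2) by blast
qed

lemma coprime_of_det:
  fixes m n m' n' :: int
  assumes "(m * n' - n * m')\<^sup>2 = 1"
  shows "coprime m n"
proof (rule coprimeI)
  fix c assume "c dvd m" "c dvd n"
  hence "c dvd m * n' - n * m'" by simp
  moreover have "m * n' - n * m' = 1 \<or> m * n' - n * m' = - 1" using assms by (simp add: power2_eq_1_iff)
  ultimately show "is_unit c" by auto
qed

context
  fixes \<alpha> :: real assumes \<alpha>: "0 < \<alpha>"
begin

text \<open>The parameter \<alpha> cancels, so tangency of Ford circles is decided by an integer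
  determinant.\<close>

lemma lor_ford: "lorentz (ford \<alpha> m n) (ford \<alpha> m' n') = 1 - 2 * (m * n' - n * m')\<^sup>2"
  using \<alpha> by (simp add: ford_def field_simps power2_eq_square)

lemma descartes_ford_root: "descartes (ford_root \<alpha>)"
  unfolding descartes_def
proof (intro conjI allI impI)
  show "lorentz (ford_root \<alpha> i) (ford_root \<alpha> j) = (if i = j then 1 else - 1)" for i j
    using exhaust_4[of i] exhaust_4[of j]
    by (auto simp: ford_root_def lor_ford lor_axis_ford lor_axis)
next
  fix v assume *: "\<forall>i. lorentz v (ford_root \<alpha> i) = 0"
  obtain b x y e where v: "v = (b, x, y, e)" by (cases v)
  have "y = 0" using spec[OF *, of 1] by (simp add: v ford_root_def axis_vec_def)
  moreover have "e = 0" using spec[OF *, of 2] calculation \<alpha> by (simp add: v ford_root_def ford_def)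
  moreover have "x = b / \<alpha>" using spec[OF *, of 3] calculation \<alpha>
    by (simp add: v ford_root_def ford_def field_simps power2_eq_square)
  moreover have "x * (1 + \<alpha>) = b / \<alpha>"
  proof -
    have "x * (2 * (1 + \<alpha>) / \<alpha>) = b * (4 / \<alpha>\<^sup>2) / 2"
      using spec[OF *, of 4] calculation(1,2) by (simp add: v ford_root_def ford_def algebra_simps)
    hence "x * ((2 + 2 * \<alpha>) * \<alpha>) = 2 * b"
      using \<alpha> by (simp add: divide_simps power2_eq_square split: if_splits)
    hence "x * (1 + \<alpha>) * \<alpha> = b" by algebra
    thus ?thesis using \<alpha> by (simp add: field_simps)
  qed
  ultimately have "x = 0" "b = 0" using \<alpha> by (auto simp: algebra_simps)
  thus "v = 0" using \<open>y = 0\<close> \<open>e = 0\<close> by (simp add: v zero_prod_def)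
qed

text \<open>As long as the axis stays, the other three circles belong to integer vectors with sum
  zero of which any two form a basis of the lattice (a superbase). A swap replaces one vector by the
  difference of the other two.\<close>

lemma ford_root_red:
  assumes "reduced (ford_root \<alpha>) p l J" "1 \<notin> J"
  shows "p 1 = axis_vec \<and> (\<exists>m n. (\<forall>i. i \<noteq> 1 \<longrightarrow> p i = ford \<alpha> (m i) (n i)) \<and>
    m 2 + m 3 + m 4 = 0 \<and> n 2 + n 3 + n 4 = 0 \<and> (m 2 * n 3 - n 2 * m 3)\<^sup>2 = 1)"
  using assms
proof (induction rule: reduced.induct)
  case refl
  show ?case
    by (intro conjI exI[of _ "\<lambda>i. if i = 2 then 1 else if i = 3 then 0 else - 1"]
        exI[of _ "\<lambda>i. if i = 2 then 0 else if i = 3 then 1 else - 1"]) (auto simp: ford_root_def)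
next
  case (step p l J k)
  then obtain m n :: "4 \<Rightarrow> int" where p: "p 1 = axis_vec" "\<And>i. i \<noteq> 1 \<Longrightarrow> p i = ford \<alpha> (m i) (n i)" and
    s: "m 2 + m 3 + m 4 = 0" "n 2 + n 3 + n 4 = 0" "(m 2 * n 3 - n 2 * m 3)\<^sup>2 = 1" by auto
  \<comment> \<open>The parallelogram law 2 Q(v) + 2 Q(w) - Q(v + w) = Q(v - w) for the quadratic
    entries of a Ford vector; in the constant third entry the axis contributes the
    correction.\<close>
  have flip: "2 *\<^sub>R (axis_vec + ford \<alpha> m1 n1 + ford \<alpha> m2 n2 + ford \<alpha> m3 n3) - 3 *\<^sub>R ford \<alpha> m3 n3
      = ford \<alpha> (m1 - m2) (n1 - n2)" if "m1 + m2 + m3 = 0" "n1 + n2 + n3 = 0" for m1 n1 m2 n2 m3 n3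
  proof -
    have 3: "m3 = - m1 - m2" "n3 = - n1 - n2" using that by auto
    show ?thesis unfolding 3 using \<alpha> by (simp add: ford_def axis_vec_def field_simps power2_eq_square)
  qed
  have k: "k = 2 \<or> k = 3 \<or> k = 4" using exhaust_4[of k] step.prems by auto
  have sum: "(\<Sum>i\<in>UNIV. p i) = axis_vec + ford \<alpha> (m 2) (n 2) + ford \<alpha> (m 3) (n 3) + ford \<alpha> (m 4) (n 4)"
    by (simp add: sum_4 p)
  \<comment> \<open>The swapped vector becomes v - w, and v changes its sign, which restores the sum
    zero: (v - w) + (-v) + w = 0.\<close>
  define m' n' :: "4 \<Rightarrow> int" where "m' = (\<lambda>i. if k = 2 then (if i = 2 then m 3 - m 4 else if i = 3 then - m 3 else m 4)
      else if k = 3 then (if i = 2 then - m 2 else if i = 3 then m 2 - m 4 else m 4)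
      else (if i = 2 then - m 2 else if i = 3 then m 3 else m 2 - m 3))"
    and "n' = (\<lambda>i. if k = 2 then (if i = 2 then n 3 - n 4 else if i = 3 then - n 3 else n 4)
      else if k = 3 then (if i = 2 then - n 2 else if i = 3 then n 2 - n 4 else n 4)
      else (if i = 2 then - n 2 else if i = 3 then n 3 else n 2 - n 3))"
  have "swap k p i = ford \<alpha> (m' i) (n' i)" if "i \<noteq> 1" for i :: 4
  proof (cases "i = k")
    case False
    thus ?thesis using k exhaust_4[of i] that p by (auto simp: swap_apply m'_def n'_def ford_minus)
  next
    case True
    have "swap k p k = ford \<alpha> (m' k) (n' k)"
      unfolding swap_apply_sum sum
      using k flip[of "m 2" "m 3" "m 4" "n 2" "n 3" "n 4"] flip[of "m 2" "m 4" "m 3" "n 2" "n 4" "n 3"]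
        flip[of "m 3" "m 4" "m 2" "n 3" "n 4" "n 2"] s
      by (auto simp: p m'_def n'_def algebra_simps)
    thus ?thesis using True by simp
  qed
  moreover have "m' 2 + m' 3 + m' 4 = 0" "n' 2 + n' 3 + n' 4 = 0"
    using k by (auto simp: m'_def n'_def)
  moreover have "(m' 2 * n' 3 - n' 2 * m' 3)\<^sup>2 = 1"
  proof -
    have e: "m 4 = - m 2 - m 3" "n 4 = - n 2 - n 3" using s by auto
    show ?thesis using k s(3) unfolding m'_def n'_def e
      by (elim disjE) (simp_all add: power2_eq_square algebra_simps)
  qed
  moreover have "swap k p 1 = axis_vec" using k p by (auto simp: swap_apply)
  ultimately show ?case by blast
qed

text \<open>A circle tangent to the axis is reached by a word that never swaps the axis. The partner
  (m', n') is another vector of the superbase.\<close>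

lemma reach_tangent_axis:
  assumes "reach (ford_root \<alpha>) p" "lorentz axis_vec (p i) = - 1"
  shows "\<exists>m n m' n'. p i = ford \<alpha> m n \<and> (m * n' - n * m')\<^sup>2 = 1"
proof -
  have 1: "ford_root \<alpha> 1 = axis_vec" by (simp add: ford_root_def)
  obtain r l J where r: "reduced (ford_root \<alpha>) r l J" "r i = p i" "1 \<notin> J"
    using red_tangent[OF descartes_ford_root assms(1), of 1 i] assms(2) unfolding 1 by metis
  obtain m n where mn: "r 1 = axis_vec" "\<forall>i. i \<noteq> 1 \<longrightarrow> r i = ford \<alpha> (m i) (n i)"
    "m 2 + m 3 + m 4 = 0" "n 2 + n 3 + n 4 = 0" "(m 2 * n 3 - n 2 * m 3)\<^sup>2 = 1"
    using ford_root_red[OF r(1,3)] by blast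
  have i: "i \<noteq> 1"
  proof
    assume "i = 1"
    hence "p i = axis_vec" using mn r by simp
    thus False using assms(2) lor_axis by simp
  qed
  define j :: 4 where "j = (if i = 2 then 3 else 2)"
  have e: "m 4 = - m 2 - m 3" "n 4 = - n 2 - n 3" using mn by auto
  have "i = 2 \<or> i = 3 \<or> i = 4" using exhaust_4[of i] i by auto
  hence "(m i * n j - n i * m j)\<^sup>2 = 1" using mn(5)
    by (elim disjE) (simp_all add: j_def e power2_eq_square algebra_simps)
  thus ?thesis using mn(2) i r(2) by metis
qed

lemma pack_eq_ford:
  "pack \<alpha> = generated_packing {circ_of (ford \<alpha> 1 0), circ_of (ford \<alpha> 0 1), circ_of axis_vec}"
  using \<alpha> unfolding pack_def
  by (simp add: horocircle_eq_circ_of axis_circle_eq_circ_of ford_def axis_vec_def power_divide)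

text \<open>The circles of the orbit are closed under \<open>packing_step\<close>: a mutually
  tangent triple lies in one quadruple, and a circle tangent to the triple is its fourth member or
  the swapped one.\<close>

lemma pack_imp_reach:
  assumes "C \<in> pack \<alpha>"
  shows "\<exists>p i. reach (ford_root \<alpha>) p \<and> C = circ_of (p i)"
proof -
  define T where "T = {circ_of (p i) | p i. reach (ford_root \<alpha>) p}"
  note q = descartes_ford_root
  have norm: "lorentz (p i) (p i) = 1" if "reach (ford_root \<alpha>) p" for p i
    using descartes_reach[OF that q] by (simp add: descartes_def)
  \<comment> \<open>Tangency alone also allows the product 1; for distinct circles of the orbit
    \<open>lor_reach\<close> excludes it.\<close>
  have tan: "lorentz (p i) (r j) = - 1" if "reach (ford_root \<alpha>) p" "reach (ford_root \<alpha>) r"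
    "tangent (circ_of (p i)) (circ_of (r j))" for p r i j
  proof -
    have "p i \<noteq> r j" using not_tangent_self[OF is_circle_circ_of[OF norm[OF that(1)]]] that(3) by metis
    thus ?thesis using lor_reach[OF q that(1,2), of i j] tangent_lor[OF norm[OF that(1)] norm[OF that(2)] that(3)] by auto
  qed
  have "packing_step T \<subseteq> T"
  proof
    fix D assume "D \<in> packing_step T"
    then consider "D \<in> T" | A B C where "is_circle D" "A \<in> T" "B \<in> T" "C \<in> T"
      "mutually_tangent A B C" "\<forall>E\<in>{A, B, C}. tangent D E \<and> snd D \<inter> snd E = {}"
      unfolding packing_step_def by blast
    thus "D \<in> T"
    proof cases
      case 2
      obtain v where v: "lorentz v v = 1" "D = circ_of v" using is_circle_imp_circ_of[OF 2(1)] .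
      obtain p1 a p2 b p3 c where r: "reach (ford_root \<alpha>) p1" "A = circ_of (p1 a)"
        "reach (ford_root \<alpha>) p2" "B = circ_of (p2 b)" "reach (ford_root \<alpha>) p3" "C = circ_of (p3 c)"
        using 2(2,3,4) unfolding T_def by blast
      have l: "lorentz (p1 a) (p2 b) = - 1" "lorentz (p2 b) (p3 c) = - 1" "lorentz (p1 a) (p3 c) = - 1"
        using 2(5) tan r unfolding mutually_tangent_def by auto
      obtain p where p: "reach (ford_root \<alpha>) p" "p1 a = p a" "p2 b = p b" "p3 c = p c"
        using tangent_triple_in_quad[OF q r(1) HOL.refl r(3) HOL.refl r(5) HOL.refl l(1,3,2)] by blast
      have d: "lorentz v (p i) = - 1" if "i \<in> {a, b, c}" for i
        using 2(6) r p v that tangent_disjoint_lor[OF v(1) norm[OF p(1)], of i] by auto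
      have "a \<noteq> b" "a \<noteq> c" "b \<noteq> c" using l norm[OF p(1)] p by auto
      hence "card (UNIV - {a, b, c}) = 1" by (simp add: card_Diff_subset)
      then obtain k where "UNIV - {a, b, c} = {k}" by (rule card_1_singletonE)
      hence "v = p k \<or> v = swap k p k"
        using descartes_fourth[OF descartes_reach[OF p(1) q] v(1), of k] d by blast
      thus ?thesis using v p(1) reach.step[OF p(1)] unfolding T_def by blast
    qed
  qed
  moreover have "circ_of (ford_root \<alpha> i) \<in> T" for i unfolding T_def using reach.refl by blast
  from this[of 1] this[of 2] this[of 3]
  have "{circ_of (ford \<alpha> 1 0), circ_of (ford \<alpha> 0 1), circ_of axis_vec} \<subseteq> T"
    by (simp add: ford_root_def)
  ultimately have "pack \<alpha> \<subseteq> T" unfolding pack_eq_ford using generated_packing_least by blast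
  thus ?thesis using assms unfolding T_def by blast
qed

text \<open>A horocircle has product -1 with the axis, so its vector is a Ford vector; comparing
  entries gives curvature and abscissa.\<close>

lemma horocircle_in_pack:
  assumes "horocircle t k \<in> pack \<alpha>" "0 < k"
  shows "\<exists>(m::int) (n::int). k = (m * \<alpha> + n)\<^sup>2 \<and> t * (\<alpha> * (m * \<alpha> + n)) = 2 * n"
proof -
  obtain p i where p: "reach (ford_root \<alpha>) p" "horocircle t k = circ_of (p i)"
    using pack_imp_reach[OF assms(1)] by blast
  have "lorentz (p i) (p i) = 1" using descartes_reach[OF p(1) descartes_ford_root] by (simp add: descartes_def)
  hence e: "p i = (k, k * t, 1, k * t\<^sup>2)" using circ_of_eq_horocircle assms(2) p(2) by metis
  hence "lorentz axis_vec (p i) = - 1" by (simp add: axis_vec_def)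
  then obtain m n where "p i = ford \<alpha> m n" using reach_tangent_axis[OF p(1)] by blast
  hence k: "k = (m * \<alpha> + n)\<^sup>2" "k * t = 2 * n * (m * \<alpha> + n) / \<alpha>" using e by (auto simp: ford_def)
  define K where "K = m * \<alpha> + n"
  have "K \<noteq> 0" "K * (t * (\<alpha> * K)) = K * (2 * n)"
    using k assms(2) \<alpha> unfolding K_def[symmetric] by (auto simp: field_simps power2_eq_square)
  hence "t * (\<alpha> * (m * \<alpha> + n)) = 2 * n" unfolding K_def[symmetric] by (metis mult_left_cancel)
  thus ?thesis using k(1) by (intro exI[of _ m] exI[of _ n]) simp
qed

text \<open>For a line other than the axis, \<open>lor_reach\<close> gives y \<ge> 1, while its unit
  normal gives y \<le> 1. So it is tangent to the axis and is a Ford circle of curvature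
  zero.\<close>

lemma line_in_pack:
  assumes "C \<in> pack \<alpha>" "is_line (fst C)"
  shows "C = axis_circle \<or> (\<exists>m n m' n' :: int. C = circ_of (ford \<alpha> m n) \<and> m * \<alpha> + n = 0 \<and> (m * n' - n * m')\<^sup>2 = 1)"
proof -
  obtain p i where p: "reach (ford_root \<alpha>) p" "C = circ_of (p i)"
    using pack_imp_reach[OF assms(1)] by blast
  obtain b x y e where v: "p i = (b, x, y, e)" by (cases "p i")
  have n: "lorentz (p i) (p i) = 1" using descartes_reach[OF p(1) descartes_ford_root] by (simp add: descartes_def)
  hence b: "b = 0" using assms(2) is_line_circ_of p(2) v by metis
  show ?thesis
  proof (cases "p i = axis_vec")
    case True
    thus ?thesis using p(2) axis_circle_eq_circ_of by (simp add: axis_vec_def)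
  next
    case False
    have "ford_root \<alpha> 1 = axis_vec" by (simp add: ford_root_def)
    hence "lorentz axis_vec (p i) \<le> - 1"
      using lor_reach[OF descartes_ford_root reach.refl p(1), of 1 i] False by metis
    hence "y \<ge> 1" by (simp add: v axis_vec_def)
    moreover have "y\<^sup>2 + x\<^sup>2 = 1" using n b by (simp add: v power2_eq_square)
    hence "y\<^sup>2 \<le> 1\<^sup>2" by (smt (verit) one_power2 zero_le_power2)
    hence "y \<le> 1" by (rule power2_le_imp_le) simp
    ultimately have "lorentz axis_vec (p i) = - 1" by (simp add: v axis_vec_def)
    then obtain m n m' n' where mn: "p i = ford \<alpha> m n" "(m * n' - n * m')\<^sup>2 = 1"
      using reach_tangent_axis[OF p(1)] by blast
    moreover have "m * \<alpha> + n = 0" using mn(1) v b by (simp add: ford_def)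
    ultimately show ?thesis using p(2) by metis
  qed
qed

section \<open>Tangent Ford circles and generation of the packing from any lattice basis\<close>

lemma basis_pos:
  fixes m n m' n' :: int
  assumes "(m * n' - n * m')\<^sup>2 = 1"
  shows "m * \<alpha> + n \<noteq> 0 \<or> n \<noteq> 0" "m * \<alpha> + n \<noteq> 0 \<or> m' * \<alpha> + n' \<noteq> 0"
proof -
  have "m \<noteq> 0 \<or> n \<noteq> 0" using assms by auto
  thus "m * \<alpha> + n \<noteq> 0 \<or> n \<noteq> 0" using \<alpha> by auto
  show "m * \<alpha> + n \<noteq> 0 \<or> m' * \<alpha> + n' \<noteq> 0"
  proof (rule ccontr)
    assume "\<not> ?thesis"
    hence "real_of_int (m * n' - n * m') = 0" by simp algebra
    hence "m * n' - n * m' = 0" by linarith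
    thus False using assms by simp
  qed
qed

lemma ford_tangent_axis:
  fixes m n m' n' :: int
  assumes "(m * n' - n * m')\<^sup>2 = 1"
  shows "tangent (circ_of (ford \<alpha> m n)) (circ_of axis_vec)" "tangent (circ_of axis_vec) (circ_of (ford \<alpha> m n))"
    "snd (circ_of (ford \<alpha> m n)) \<inter> snd (circ_of axis_vec) = {}"
proof -
  let ?k = "m * \<alpha> + n"
  have n: "lorentz (?k\<^sup>2, 2 * n * ?k / \<alpha>, 1, 4 * (real_of_int n)\<^sup>2 / \<alpha>\<^sup>2)
      (?k\<^sup>2, 2 * n * ?k / \<alpha>, 1, 4 * (real_of_int n)\<^sup>2 / \<alpha>\<^sup>2) = 1"
    using lor_ford[of m n m n] by (simp add: ford_def)
  \<comment> \<open>The sign hypothesis of \<open>lor_tangent_disjoint\<close>: positive curvature,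
    or a line at positive height.\<close>
  have pos: "?k\<^sup>2 + 0 > 0 \<or> ?k\<^sup>2 = 0 \<and> (0::real) = 0 \<and> 4 * (real_of_int n)\<^sup>2 / \<alpha>\<^sup>2 + 0 > 0"
    using basis_pos(1)[OF assms] \<alpha> by auto
  show "tangent (circ_of (ford \<alpha> m n)) (circ_of axis_vec)"
    "snd (circ_of (ford \<alpha> m n)) \<inter> snd (circ_of axis_vec) = {}"
    using lor_tangent_disjoint[OF n _ _ pos, of 0 "-1"] by (auto simp: ford_def axis_vec_def)
  thus "tangent (circ_of axis_vec) (circ_of (ford \<alpha> m n))"
    by (auto simp: tangent_def Int_commute conj_commute split: if_splits)
qed

lemma ford_tangent_ford:
  fixes m n m' n' :: int
  assumes "(m * n' - n * m')\<^sup>2 = 1"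
  shows "tangent (circ_of (ford \<alpha> m n)) (circ_of (ford \<alpha> m' n'))"
    "snd (circ_of (ford \<alpha> m n)) \<inter> snd (circ_of (ford \<alpha> m' n')) = {}"
proof -
  have "real_of_int ((m * n' - n * m')\<^sup>2) = 1" using assms by simp
  hence "lorentz (ford \<alpha> m n) (ford \<alpha> m' n') = - 1" unfolding lor_ford by simp
  moreover have "lorentz (ford \<alpha> m n) (ford \<alpha> m n) = 1" "lorentz (ford \<alpha> m' n') (ford \<alpha> m' n') = 1"
    by (simp_all add: lor_ford)
  moreover have "(m * \<alpha> + n)\<^sup>2 + (m' * \<alpha> + n')\<^sup>2 > 0"
    using basis_pos(2)[OF assms] by (simp add: sum_power2_gt_zero_iff)
  ultimately show "tangent (circ_of (ford \<alpha> m n)) (circ_of (ford \<alpha> m' n'))"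
    "snd (circ_of (ford \<alpha> m n)) \<inter> snd (circ_of (ford \<alpha> m' n')) = {}"
    unfolding ford_def using lor_tangent_disjoint by blast+
qed

text \<open>The mediant: the sum of two basis vectors has determinant \<plusminus>1 with each of
  them, so its circle is tangent to both circles and to the axis.\<close>

lemma ford_add_closed:
  fixes m n m' n' :: int
  assumes Q: "packing_step Q \<subseteq> Q" "circ_of axis_vec \<in> Q"
    and d: "(m * n' - n * m')\<^sup>2 = 1" and H: "circ_of (ford \<alpha> m n) \<in> Q" "circ_of (ford \<alpha> m' n') \<in> Q"
  shows "circ_of (ford \<alpha> (m + m') (n + n')) \<in> Q"
proof (rule packing_stepI[OF Q(1) _ Q(2) H])
  have d': "(m' * n - n' * m)\<^sup>2 = 1" "((m + m') * n - (n + n') * m)\<^sup>2 = 1" "((m + m') * n' - (n + n') * m')\<^sup>2 = 1"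
    using d by (auto simp: algebra_simps power2_commute)
  show "is_circle (circ_of (ford \<alpha> (m + m') (n + n')))"
    by (rule is_circle_circ_of) (simp add: lor_ford)
  show "tangent (circ_of axis_vec) (circ_of (ford \<alpha> m n))" "tangent (circ_of axis_vec) (circ_of (ford \<alpha> m' n'))"
    "tangent (circ_of (ford \<alpha> (m + m') (n + n'))) (circ_of axis_vec)"
    "snd (circ_of (ford \<alpha> (m + m') (n + n'))) \<inter> snd (circ_of axis_vec) = {}"
    using ford_tangent_axis[OF d] ford_tangent_axis[OF d'(1)] ford_tangent_axis[OF d'(2)] by blast+
  show "tangent (circ_of (ford \<alpha> m n)) (circ_of (ford \<alpha> m' n'))"
    "tangent (circ_of (ford \<alpha> (m + m') (n + n'))) (circ_of (ford \<alpha> m n))"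
    "tangent (circ_of (ford \<alpha> (m + m') (n + n'))) (circ_of (ford \<alpha> m' n'))"
    "snd (circ_of (ford \<alpha> (m + m') (n + n'))) \<inter> snd (circ_of (ford \<alpha> m n)) = {}"
    "snd (circ_of (ford \<alpha> (m + m') (n + n'))) \<inter> snd (circ_of (ford \<alpha> m' n')) = {}"
    using ford_tangent_ford[OF d] ford_tangent_ford[OF d'(2)] ford_tangent_ford[OF d'(3)] by blast+
qed

text \<open>The Euclidean algorithm on (a, c). The basis varies in the induction: subtracting one
  coefficient from the other is compensated by a change of basis that leaves the combination fixed,
  as in a v + c v' = (a - s c) v + c (v' + s v).\<close>

lemma ford_closed:
  fixes m n m' n' a c :: int
  assumes Q: "packing_step Q \<subseteq> Q" "circ_of axis_vec \<in> Q"
    and "(m * n' - n * m')\<^sup>2 = 1" "circ_of (ford \<alpha> m n) \<in> Q" "circ_of (ford \<alpha> m' n') \<in> Q"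
    and "coprime a c"
  shows "circ_of (ford \<alpha> (a * m + c * m') (a * n + c * n')) \<in> Q"
  using assms(3-)
proof (induction "nat (\<bar>a\<bar> + \<bar>c\<bar>)" arbitrary: a c m n m' n' rule: less_induct)
  case less
  note d = less.prems(1) and H = less.prems(2,3)
  have add: "circ_of (ford \<alpha> (m + m') (n + n')) \<in> Q"
    by (rule ford_add_closed[OF Q d H])
  \<comment> \<open>The vectors v' and -v' have the same circle, so differences are as available as
    sums.\<close>
  have sub: "circ_of (ford \<alpha> (m - m') (n - n')) \<in> Q"
    using ford_add_closed[OF Q, of m "-n'" n "-m'"] d H ford_minus[of \<alpha> m' n'] by (simp add: power2_commute)
  have d': "(m' * n - n' * m)\<^sup>2 = 1" using d by (simp add: power2_commute mult.commute)
  consider "a = 0" | "c = 0" | "a \<noteq> 0" "c \<noteq> 0" by blast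
  thus ?case
  proof cases
    case 1
    hence "c = 1 \<or> c = - 1" using less.prems(4) by auto
    thus ?thesis using 1 H ford_minus[of \<alpha> m' n'] by auto
  next
    case 2
    hence "a = 1 \<or> a = - 1" using less.prems(4) by auto
    thus ?thesis using 2 H ford_minus[of \<alpha> m n] by auto
  next
    case 3
    \<comment> \<open>With this sign the step decreases the larger absolute value by the smaller
      one.\<close>
    define s where "s = sgn (a * c)"
    have s: "s = 1 \<or> s = - 1" using 3 by (auto simp: s_def sgn_if)
    have S: "circ_of (ford \<alpha> (m + s * m') (n + s * n')) \<in> Q" using s add sub by auto
    have ss: "s * s = 1" using s by auto
    show ?thesis
    proof (cases "\<bar>a\<bar> \<ge> \<bar>c\<bar>")
      case True
      have "\<bar>a - s * c\<bar> = \<bar>a\<bar> - \<bar>c\<bar>" using True 3 by (auto simp: s_def sgn_if abs_if zero_less_mult_iff)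
      hence lt: "nat (\<bar>a - s * c\<bar> + \<bar>c\<bar>) < nat (\<bar>a\<bar> + \<bar>c\<bar>)" using 3 by auto
      have "circ_of (ford \<alpha> (m' + s * m) (n' + s * n)) \<in> Q"
        using S s ford_minus[of \<alpha> "m - m'" "n - n'"] by (auto simp: add.commute)
      moreover have "(m * (n' + s * n) - n * (m' + s * m))\<^sup>2 = 1" using d by (simp add: algebra_simps)
      moreover have "coprime (a - s * c) c" using coprime_diff_mult[OF less.prems(4)] .
      ultimately have "circ_of (ford \<alpha> ((a - s * c) * m + c * (m' + s * m)) ((a - s * c) * n + c * (n' + s * n))) \<in> Q"
        using less.hyps[OF lt] H by blast
      thus ?thesis by (simp add: algebra_simps)
    next
      case False
      have "\<bar>c - s * a\<bar> = \<bar>c\<bar> - \<bar>a\<bar>" using False 3 by (auto simp: s_def sgn_if abs_if zero_less_mult_iff)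
      hence lt: "nat (\<bar>a\<bar> + \<bar>c - s * a\<bar>) < nat (\<bar>a\<bar> + \<bar>c\<bar>)" using 3 by auto
      have "((m + s * m') * n' - (n + s * n') * m')\<^sup>2 = 1" using d by (simp add: algebra_simps)
      moreover have "coprime a (c - s * a)"
        using coprime_diff_mult[of c a s] less.prems(4) by (simp add: coprime_commute)
      ultimately have "circ_of (ford \<alpha> (a * (m + s * m') + (c - s * a) * m') (a * (n + s * n') + (c - s * a) * n')) \<in> Q"
        using less.hyps[OF lt] H S by blast
      thus ?thesis by (simp add: algebra_simps)
    qed
  qed
qed

lemma ford_eq_horocircle:
  assumes "m * \<alpha> + n \<noteq> 0"
  shows "circ_of (ford \<alpha> m n) = horocircle (2 * n / (\<alpha> * (m * \<alpha> + n))) ((m * \<alpha> + n)\<^sup>2)"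
proof -
  define K where "K = m * \<alpha> + n"
  have K: "K \<noteq> 0" using assms by (simp add: K_def)
  hence "2 * n * K / \<alpha> = K\<^sup>2 * (2 * n / (\<alpha> * K))"
    "4 * (real_of_int n)\<^sup>2 / \<alpha>\<^sup>2 = K\<^sup>2 * (2 * n / (\<alpha> * K))\<^sup>2"
    using \<alpha> by (simp_all add: power2_eq_square)
  thus ?thesis using K by (simp add: horocircle_eq_circ_of ford_def flip: K_def)
qed

text \<open>Both vectors are primitive, so \<open>ford_closed\<close> over the standard basis puts
  their circles into the packing; conversely the standard basis consists of primitive combinations
  of the given one.\<close>

lemma pack_generated_by_basis:
  fixes m n m' n' :: int
  assumes d: "(m * n' - n * m')\<^sup>2 = 1"
  shows "generated_packing {circ_of (ford \<alpha> m n), circ_of (ford \<alpha> m' n'), circ_of axis_vec} = pack \<alpha>"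
    (is "generated_packing ?P = _")
proof
  have "packing_step (pack \<alpha>) \<subseteq> pack \<alpha>" "circ_of axis_vec \<in> pack \<alpha>"
    "circ_of (ford \<alpha> 1 0) \<in> pack \<alpha>" "circ_of (ford \<alpha> 0 1) \<in> pack \<alpha>"
    unfolding pack_eq_ford by (auto intro!: packing_step_generated subsetD[OF generated_packing_base])
  note cl = ford_closed[OF this(1,2) _ this(3,4), simplified]
  have "coprime m' n'"
    by (rule coprime_of_det[of _ n _ m]) (use d in \<open>simp add: power2_commute mult.commute\<close>)
  hence "?P \<subseteq> pack \<alpha>" using cl coprime_of_det[OF d] \<open>circ_of axis_vec \<in> pack \<alpha>\<close> by blast
  thus "generated_packing ?P \<subseteq> pack \<alpha>"
    by (rule generated_packing_least) fact
  let ?G = "generated_packing ?P"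
  have G: "packing_step ?G \<subseteq> ?G" "circ_of axis_vec \<in> ?G"
    "circ_of (ford \<alpha> m n) \<in> ?G" "circ_of (ford \<alpha> m' n') \<in> ?G"
    by (auto intro!: packing_step_generated subsetD[OF generated_packing_base])
  note cl' = ford_closed[OF G(1,2) d G(3,4)]
  define D where "D = m * n' - n * m'"
  have D: "D * D = 1" using d by (simp add: D_def power2_eq_square)
  have "coprime n' n" "coprime m' m"
    using coprime_of_det[of n' m n m'] coprime_of_det[of m' n m n'] d
    by (simp_all add: power2_commute mult.commute)
  \<comment> \<open>The rows of the adjugate matrix are the coefficients that express (D, 0) and (0,
    D).\<close>
  hence "coprime n' (- n)" "coprime (- m') m" by auto
  from cl'[OF this(1)] cl'[OF this(2)]
  have "circ_of (ford \<alpha> D 0) \<in> ?G" "circ_of (ford \<alpha> 0 D) \<in> ?G"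
    by (auto simp: D_def algebra_simps)
  moreover have "D = 1 \<or> D = - 1" using D by (simp add: zmult_eq_1_iff)
  ultimately have "circ_of (ford \<alpha> 1 0) \<in> ?G" "circ_of (ford \<alpha> 0 1) \<in> ?G"
    using ford_minus[of \<alpha> 1 0] ford_minus[of \<alpha> 0 1] by auto
  thus "pack \<alpha> \<subseteq> ?G" unfolding pack_eq_ford
    by (intro generated_packing_least) (use G in auto)
qed

end


section \<open>Similarities\<close>

definition img :: "(real^2 \<Rightarrow> real^2) \<Rightarrow> circ \<Rightarrow> circ" where
  "img \<Phi> C = (\<Phi> ` fst C, \<Phi> ` snd C)"

lemma image_packing_img: "image_packing \<Phi> P = img \<Phi> ` P"
  by (simp add: image_packing_def img_def)

lemma similarityE:
  assumes "similarity \<Phi>"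
  obtains \<mu> A b where "0 < \<mu>" "orthogonal_matrix A" "\<Phi> = (\<lambda>x. \<mu> *\<^sub>R (A *v x) + b)"
  using assms unfolding similarity_def by blast

lemma similarity_dist:
  fixes A :: "real^2^2"
  assumes "0 < \<mu>" "orthogonal_matrix A" "\<Phi> = (\<lambda>x. \<mu> *\<^sub>R (A *v x) + b)"
  shows "dist (\<Phi> x) (\<Phi> y) = \<mu> * dist x y"
proof -
  have "orthogonal_transformation (\<lambda>x. A *v x)"
    using assms(2) by (simp add: orthogonal_transformation_matrix matrix_vector_mul_linear)
  hence "norm (A *v (x - y)) = norm (x - y)" by (rule orthogonal_transformation_norm)
  moreover have "\<Phi> x - \<Phi> y = \<mu> *\<^sub>R (A *v (x - y))"
    unfolding assms(3) by (simp add: matrix_vector_mult_diff_distrib scaleR_diff_right)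
  ultimately show ?thesis using assms(1) by (simp add: dist_norm)
qed

lemma similarity_inverse:
  assumes "similarity \<Phi>"
  shows "\<exists>\<Psi>. similarity \<Psi> \<and> (\<forall>x. \<Psi> (\<Phi> x) = x) \<and> (\<forall>x. \<Phi> (\<Psi> x) = x)"
proof -
  obtain \<mu> A b where \<Phi>: "0 < \<mu>" "orthogonal_matrix A" "\<Phi> = (\<lambda>x. \<mu> *\<^sub>R (A *v x) + b)"
    using similarityE[OF assms] .
  define \<Psi> where "\<Psi> = (\<lambda>y. (1/\<mu>) *\<^sub>R (transpose A *v y) + (- (1/\<mu>) *\<^sub>R (transpose A *v b)))"
  have A: "transpose A ** A = mat 1" "A ** transpose A = mat 1"
    using \<Phi>(2) by (auto simp: orthogonal_matrix_def)
  have "similarity \<Psi>"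
    unfolding similarity_def using \<Phi> by (intro exI conjI, rule_tac [3] \<Psi>_def) auto
  moreover have "\<Psi> (\<Phi> x) = x" for x
    using \<Phi>(1) unfolding \<Phi>(3) \<Psi>_def
    by (simp add: matrix_vector_right_distrib matrix_vector_mult_scaleR scaleR_add_right matrix_vector_mul_assoc A)
  moreover have "\<Phi> (\<Psi> x) = x" for x
    using \<Phi>(1) unfolding \<Phi>(3) \<Psi>_def
    by (simp add: matrix_vector_right_distrib matrix_vector_mult_scaleR scaleR_add_right matrix_vector_mul_assoc A
        matrix_vector_mult_diff_distrib scaleR_diff_right del: transpose_matrix_vector)
  ultimately show ?thesis by blast
qed

lemma similarity_comp:
  assumes "similarity \<Phi>" "similarity \<Psi>"
  shows "similarity (\<Psi> \<circ> \<Phi>)"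
proof -
  obtain \<mu> A b where \<Phi>: "0 < \<mu>" "orthogonal_matrix A" "\<Phi> = (\<lambda>x. \<mu> *\<^sub>R (A *v x) + b)"
    using similarityE[OF assms(1)] .
  obtain \<nu> B c where \<Psi>: "0 < \<nu>" "orthogonal_matrix B" "\<Psi> = (\<lambda>x. \<nu> *\<^sub>R (B *v x) + c)"
    using similarityE[OF assms(2)] .
  have "\<Psi> \<circ> \<Phi> = (\<lambda>x. (\<nu> * \<mu>) *\<^sub>R ((B ** A) *v x) + (\<nu> *\<^sub>R (B *v b) + c))"
    unfolding \<Phi>(3) \<Psi>(3)
    by (simp add: fun_eq_iff matrix_vector_right_distrib matrix_vector_mult_scaleR scaleR_add_right matrix_vector_mul_assoc)
  thus ?thesis unfolding similarity_def using \<Phi> \<Psi> orthogonal_matrix_mul by (metis mult_pos_pos)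
qed

lemma orientation_preserving_comp:
  assumes "orientation_preserving \<Phi>" "orientation_preserving \<Psi>"
  shows "orientation_preserving (\<Psi> \<circ> \<Phi>)"
proof -
  obtain \<mu> A b where \<Phi>: "0 < \<mu>" "orthogonal_matrix A" "det A = 1" "\<Phi> = (\<lambda>x. \<mu> *\<^sub>R (A *v x) + b)"
    using assms(1) unfolding orientation_preserving_def by blast
  obtain \<nu> B c where \<Psi>: "0 < \<nu>" "orthogonal_matrix B" "det B = 1" "\<Psi> = (\<lambda>x. \<nu> *\<^sub>R (B *v x) + c)"
    using assms(2) unfolding orientation_preserving_def by blast
  have "\<Psi> \<circ> \<Phi> = (\<lambda>x. (\<nu> * \<mu>) *\<^sub>R ((B ** A) *v x) + (\<nu> *\<^sub>R (B *v b) + c))"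
    unfolding \<Phi>(4) \<Psi>(4)
    by (simp add: fun_eq_iff matrix_vector_right_distrib matrix_vector_mult_scaleR scaleR_add_right matrix_vector_mul_assoc)
  moreover have "det (B ** A) = 1" using \<Phi> \<Psi> by (simp add: det_mul)
  ultimately show ?thesis unfolding orientation_preserving_def using \<Phi> \<Psi> orthogonal_matrix_mul by (metis mult_pos_pos)
qed

lemma similarity_bij:
  assumes "similarity \<Phi>"
  shows "bij \<Phi>"
proof -
  obtain \<Psi> where "similarity \<Psi>" "\<And>x. \<Psi> (\<Phi> x) = x" "\<And>x. \<Phi> (\<Psi> x) = x"
    using similarity_inverse[OF assms] by auto
  hence "\<Psi> \<circ> \<Phi> = id" "\<Phi> \<circ> \<Psi> = id" by auto
  thus ?thesis by (rule o_bij)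
qed

lemma similarity_continuous: "similarity \<Phi> \<Longrightarrow> continuous_on S \<Phi>"
  by (elim similarityE) (auto intro!: continuous_intros matrix_vector_mult_linear_continuous_on)

lemma similarity_ball_sphere:
  fixes A :: "real^2^2"
  assumes "0 < \<mu>" "orthogonal_matrix A" "\<Phi> = (\<lambda>x. \<mu> *\<^sub>R (A *v x) + b)"
  shows "\<Phi> ` ball z r = ball (\<Phi> z) (\<mu> * r)" "\<Phi> ` sphere z r = sphere (\<Phi> z) (\<mu> * r)"
proof -
  have "similarity \<Phi>" unfolding similarity_def using assms by blast
  then obtain \<Psi> where \<Psi>: "\<And>x. \<Phi> (\<Psi> x) = x" using similarity_inverse by blast
  have d: "dist (\<Phi> x) (\<Phi> y) = \<mu> * dist x y" for x y using similarity_dist[OF assms] .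
  have "\<Phi> x \<in> ball (\<Phi> z) (\<mu> * r) \<longleftrightarrow> x \<in> ball z r" "\<Phi> x \<in> sphere (\<Phi> z) (\<mu> * r) \<longleftrightarrow> x \<in> sphere z r" for x
    using assms(1) by (auto simp: d)
  thus "\<Phi> ` ball z r = ball (\<Phi> z) (\<mu> * r)" "\<Phi> ` sphere z r = sphere (\<Phi> z) (\<mu> * r)"
    using \<Psi> by (metis (no_types, lifting) image_eqI subsetI subset_antisym image_subsetI)+
qed

section \<open>Action of similarities on circles, tangency and generated packings\<close>

lemma is_line_similarity:
  assumes "similarity \<Phi>" "is_line S"
  shows "is_line (\<Phi> ` S)"
proof -
  obtain \<mu> A b where \<Phi>: "0 < \<mu>" "orthogonal_matrix A" "\<Phi> = (\<lambda>x. \<mu> *\<^sub>R (A *v x) + b)"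
    using similarityE[OF assms(1)] .
  define f where "f = (\<lambda>x. \<mu> *\<^sub>R (A *v x))"
  have lin: "linear f" unfolding f_def
    by (intro linear_compose_scale_right matrix_vector_mul_linear)
  have "inj \<Phi>" using similarity_bij[OF assms(1)] bij_is_inj by blast
  hence inj: "inj f" unfolding \<Phi>(3) f_def inj_def by simp
  have im: "\<Phi> ` S = (\<lambda>x. b + x) ` f ` S" by (auto simp: \<Phi>(3) f_def image_image add.commute)
  have "aff_dim (\<Phi> ` S) = 1"
    unfolding im aff_dim_translation_eq aff_dim_injective_linear_image[OF lin inj]
    using assms(2) by (simp add: is_line_def)
  moreover have "affine (\<Phi> ` S)"
    unfolding affine_def
  proof safe
    fix x y u v assume *: "x \<in> S" "y \<in> S" "u + v = (1::real)"
    have "u *\<^sub>R x + v *\<^sub>R y \<in> S" using assms(2) * by (auto simp: is_line_def affine_def)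
    moreover have "u *\<^sub>R \<Phi> x + v *\<^sub>R \<Phi> y = f (u *\<^sub>R x + v *\<^sub>R y) + (u + v) *\<^sub>R b"
      by (simp add: linear_add[OF lin] linear_scale[OF lin]) (simp add: \<Phi>(3) f_def algebra_simps)
    hence "u *\<^sub>R \<Phi> x + v *\<^sub>R \<Phi> y = \<Phi> (u *\<^sub>R x + v *\<^sub>R y)" using * by (simp add: \<Phi>(3) f_def)
    ultimately show "u *\<^sub>R \<Phi> x + v *\<^sub>R \<Phi> y \<in> \<Phi> ` S" by blast
  qed
  ultimately show ?thesis by (simp add: is_line_def)
qed

lemma is_circle_img:
  assumes "similarity \<Phi>" "is_circle C"
  shows "is_circle (img \<Phi> C)"
proof -
  obtain \<mu> A b where \<Phi>: "0 < \<mu>" "orthogonal_matrix A" "\<Phi> = (\<lambda>x. \<mu> *\<^sub>R (A *v x) + b)"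
    using similarityE[OF assms(1)] .
  obtain \<Psi> where \<Psi>: "similarity \<Psi>" "\<And>x. \<Psi> (\<Phi> x) = x" "\<And>x. \<Phi> (\<Psi> x) = x"
    using similarity_inverse[OF assms(1)] by auto
  have "is_line (\<Phi> ` fst C) \<or> (\<exists>z r. 0 < r \<and> \<Phi> ` fst C = sphere z r)"
    using assms(2) is_line_similarity[OF assms(1)] similarity_ball_sphere(2)[OF \<Phi>] \<Phi>(1)
    unfolding is_circle_def by (metis mult_pos_pos)
  moreover have "\<Phi> ` snd C \<in> components (- \<Phi> ` fst C)"
    unfolding in_components_maximal
  proof (intro conjI allI impI)
    have C: "snd C \<noteq> {}" "snd C \<subseteq> - fst C" "connected (snd C)"
      and max: "\<And>D. D \<noteq> {} \<Longrightarrow> snd C \<subseteq> D \<Longrightarrow> D \<subseteq> - fst C \<Longrightarrow> connected D \<Longrightarrow> D = snd C"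
      using assms(2) unfolding is_circle_def in_components_maximal by blast+
    show "\<Phi> ` snd C \<noteq> {}" using C by simp
    show "\<Phi> ` snd C \<subseteq> - \<Phi> ` fst C" using C(2) \<Psi>(2) by (force dest: arg_cong[of _ _ \<Psi>])
    show "connected (\<Phi> ` snd C)"
      using C(3) similarity_continuous[OF assms(1)] by (rule connected_continuous_image[rotated])
    fix D assume D: "D \<noteq> {} \<and> \<Phi> ` snd C \<subseteq> D \<and> D \<subseteq> - \<Phi> ` fst C \<and> connected D"
    \<comment> \<open>Maximality is tested by pulling a competing connected set back along the
      inverse.\<close>
    have "\<Psi> ` D = snd C"
    proof (rule max)
      show "\<Psi> ` D \<noteq> {}" using D by simp
      show "snd C \<subseteq> \<Psi> ` D" using D \<Psi>(2) by (metis image_eqI image_subset_iff subsetI)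
      show "\<Psi> ` D \<subseteq> - fst C"
      proof
        fix x assume "x \<in> \<Psi> ` D"
        hence "\<Phi> x \<in> D" using \<Psi>(3) by auto
        thus "x \<in> - fst C" using D by auto
      qed
      show "connected (\<Psi> ` D)"
        using D similarity_continuous[OF \<Psi>(1)] connected_continuous_image by blast
    qed
    thus "D = \<Phi> ` snd C" using \<Psi>(3) by (metis (no_types, lifting) image_cong image_ident image_image)
  qed
  ultimately show ?thesis by (simp add: is_circle_def img_def)
qed

lemma tangent_img:
  assumes "similarity \<Phi>" "tangent C D"
  shows "tangent (img \<Phi> C) (img \<Phi> D)"
proof -
  obtain \<Psi> where \<Psi>: "similarity \<Psi>" "\<And>x. \<Psi> (\<Phi> x) = x" "\<And>x. \<Phi> (\<Psi> x) = x"
    using similarity_inverse[OF assms(1)] by auto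
  have "\<Psi> ` \<Phi> ` S = S" for S using \<Psi>(2) by (simp add: image_image)
  hence "is_line (\<Phi> ` S) \<longleftrightarrow> is_line S" for S
    using is_line_similarity[OF assms(1)] is_line_similarity[OF \<Psi>(1)] by metis
  moreover have "\<Phi> ` S \<inter> \<Phi> ` T = \<Phi> ` (S \<inter> T)" for S T
    using similarity_bij[OF assms(1)] by (simp add: image_Int bij_is_inj)
  ultimately show ?thesis using assms(2) by (auto simp: tangent_def img_def split: if_splits)
qed

lemma disjoint_img:
  assumes "similarity \<Phi>" "snd C \<inter> snd D = {}"
  shows "snd (img \<Phi> C) \<inter> snd (img \<Phi> D) = {}"
  using assms image_Int[OF bij_is_inj[OF similarity_bij[OF assms(1)]], of "snd C" "snd D"] by (simp add: img_def)

lemma img_comp: "img (\<Psi> \<circ> \<Phi>) C = img \<Psi> (img \<Phi> C)"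
  by (simp add: img_def image_comp)

text \<open>The preimage of the packing on the right is closed under \<open>packing_step\<close>,
  because similarities preserve circles, tangency and disjointness.\<close>

lemma img_generated_packing_subset:
  assumes "similarity \<Phi>"
  shows "img \<Phi> ` generated_packing P \<subseteq> generated_packing (img \<Phi> ` P)"
proof -
  let ?G = "generated_packing (img \<Phi> ` P)"
  have "packing_step {C. img \<Phi> C \<in> ?G} \<subseteq> {C. img \<Phi> C \<in> ?G}"
  proof
    fix D assume "D \<in> packing_step {C. img \<Phi> C \<in> ?G}"
    then consider "img \<Phi> D \<in> ?G" | A B C where "is_circle D" "img \<Phi> A \<in> ?G" "img \<Phi> B \<in> ?G" "img \<Phi> C \<in> ?G"
      "mutually_tangent A B C" "\<forall>E\<in>{A, B, C}. tangent D E \<and> snd D \<inter> snd E = {}"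
      unfolding packing_step_def by blast
    thus "D \<in> {C. img \<Phi> C \<in> ?G}"
    proof cases
      case 2
      have "img \<Phi> D \<in> ?G"
        by (rule packing_stepI[OF packing_step_generated is_circle_img[OF assms 2(1)] 2(2,3,4)];
            (intro tangent_img[OF assms] disjoint_img[OF assms])?)
          (use 2(5,6) in \<open>auto simp: mutually_tangent_def\<close>)
      thus ?thesis by simp
    qed simp
  qed
  moreover have "P \<subseteq> {C. img \<Phi> C \<in> ?G}" using generated_packing_base[of "img \<Phi> ` P"] by blast
  ultimately have "generated_packing P \<subseteq> {C. img \<Phi> C \<in> ?G}" by (rule generated_packing_least[rotated])
  thus ?thesis by blast
qed

lemma image_packing_generated:
  assumes "similarity \<Phi>"
  shows "image_packing \<Phi> (generated_packing P) = generated_packing (image_packing \<Phi> P)"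
  unfolding image_packing_img
proof
  obtain \<Psi> where \<Psi>: "similarity \<Psi>" "\<And>x. \<Psi> (\<Phi> x) = x" "\<And>x. \<Phi> (\<Psi> x) = x"
    using similarity_inverse[OF assms] by auto
  have inv: "img \<Psi> (img \<Phi> C) = C" "img \<Phi> (img \<Psi> C) = C" for C
    using \<Psi> by (simp_all add: img_def image_image)
  show "img \<Phi> ` generated_packing P \<subseteq> generated_packing (img \<Phi> ` P)"
    by (rule img_generated_packing_subset[OF assms])
  have "img \<Psi> ` generated_packing (img \<Phi> ` P) \<subseteq> generated_packing P"
    using img_generated_packing_subset[OF \<Psi>(1), of "img \<Phi> ` P"] by (simp add: image_image inv)
  thus "generated_packing (img \<Phi> ` P) \<subseteq> img \<Phi> ` generated_packing P"
    using inv(2) by (metis image_eqI image_subset_iff subsetI)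
qed

section \<open>Similarities that fix the axis together with the lower half-plane\<close>

definition axis_sim :: "real \<Rightarrow> real \<Rightarrow> real \<Rightarrow> real^2 \<Rightarrow> real^2" where
  "axis_sim \<sigma> \<mu> t p = vector [\<sigma> * \<mu> * p$1 + t, \<mu> * p$2]"

definition diag_sign :: "real \<Rightarrow> real^2^2" where
  "diag_sign \<sigma> = vector [vector [\<sigma>, 0], vector [0, 1]]"

lemma axis_sim_eq: "axis_sim \<sigma> \<mu> t = (\<lambda>x. \<mu> *\<^sub>R (diag_sign \<sigma> *v x) + vector [t, 0])"
  by (simp add: fun_eq_iff axis_sim_def diag_sign_def vec_eq_iff forall_2 matrix_vector_mult_def sum_2)

lemma orthogonal_diag_sign: "\<sigma> = 1 \<or> \<sigma> = - 1 \<Longrightarrow> orthogonal_matrix (diag_sign \<sigma>)"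
  by (auto simp: orthogonal_matrix_def diag_sign_def vec_eq_iff forall_2 matrix_matrix_mult_def sum_2 transpose_def mat_def)

lemma similarity_axis_sim: "\<sigma> = 1 \<or> \<sigma> = - 1 \<Longrightarrow> 0 < \<mu> \<Longrightarrow> similarity (axis_sim \<sigma> \<mu> t)"
  unfolding similarity_def axis_sim_eq using orthogonal_diag_sign by blast

text \<open>Orientation is defined by the existence of a representation, so an arbitrary one must be
  compared: its values at the unit vectors force \<nu>^2 det A = \<sigma> \<mu>^2.\<close>

lemma orientation_preserving_axis_sim:
  assumes "\<sigma> = 1 \<or> \<sigma> = - 1" "0 < \<mu>"
  shows "orientation_preserving (axis_sim \<sigma> \<mu> t) \<longleftrightarrow> \<sigma> = 1"
proof
  assume "\<sigma> = 1"
  moreover have "det (diag_sign 1) = 1" by (simp add: det_2 diag_sign_def)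
  ultimately show "orientation_preserving (axis_sim \<sigma> \<mu> t)"
    unfolding orientation_preserving_def axis_sim_eq using orthogonal_diag_sign assms(2) by blast
next
  assume "orientation_preserving (axis_sim \<sigma> \<mu> t)"
  then obtain \<nu> A b where A: "0 < \<nu>" "det A = 1" "axis_sim \<sigma> \<mu> t = (\<lambda>x. \<nu> *\<^sub>R (A *v x) + b)"
    unfolding orientation_preserving_def by blast
  have e: "axis_sim \<sigma> \<mu> t x - axis_sim \<sigma> \<mu> t 0 = \<nu> *\<^sub>R (A *v x)" for x
    unfolding A(3) by simp
  have c: "\<sigma> * \<mu> * x$1 = \<nu> * (A$1$1 * x$1 + A$1$2 * x$2)" "\<mu> * x$2 = \<nu> * (A$2$1 * x$1 + A$2$2 * x$2)"
    for x :: "real^2"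
    using e[of x] by (simp_all add: axis_sim_def vec_eq_iff forall_2 matrix_vector_mult_def sum_2)
  have "\<nu> * A$1$1 = \<sigma> * \<mu>" "\<nu> * A$2$1 = 0" "\<nu> * A$2$2 = \<mu>"
    using c[of "vector [1, 0]"] c(2)[of "vector [0, 1]"] by auto
  hence "\<nu>\<^sup>2 * det A = \<sigma> * \<mu>\<^sup>2" unfolding det_2 by algebra
  hence "\<sigma> * \<mu>\<^sup>2 = \<nu>\<^sup>2" using A(2) by simp
  moreover have "0 < \<nu>\<^sup>2" using A(1) by simp
  ultimately have "\<sigma> * \<mu>\<^sup>2 > 0" by linarith
  thus "\<sigma> = 1" using assms by (auto simp: zero_less_mult_iff)
qed

lemma img_axis_sim_horocircle:
  assumes "\<sigma> = 1 \<or> \<sigma> = - 1" "0 < \<mu>"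
  shows "img (axis_sim \<sigma> \<mu> t) (horocircle s k) = horocircle (\<sigma> * \<mu> * s + t) (k / \<mu>)"
proof -
  note b = similarity_ball_sphere[OF assms(2) orthogonal_diag_sign[OF assms(1)] axis_sim_eq, of t]
  show ?thesis unfolding img_def horocircle_def fst_conv snd_conv b
    by (simp add: axis_sim_def)
qed

lemma img_axis_sim_axis_circle:
  assumes "\<sigma> = 1 \<or> \<sigma> = - 1" "0 < \<mu>"
  shows "img (axis_sim \<sigma> \<mu> t) axis_circle = axis_circle"
proof -
  have "axis_sim \<sigma> \<mu> t (vector [\<sigma> * (p$1 - t) / \<mu>, p$2 / \<mu>]) = p" for p
    using assms by (auto simp: axis_sim_def vec_eq_iff forall_2)
  hence *: "p \<in> axis_sim \<sigma> \<mu> t ` S" if "vector [\<sigma> * (p$1 - t) / \<mu>, p$2 / \<mu>] \<in> S" for p S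
    using that by (metis image_eqI)
  have "p \<in> axis_sim \<sigma> \<mu> t ` {x. x$2 < 0}" if "p$2 < 0" for p
    by (rule *) (use that assms in \<open>simp add: divide_less_0_iff\<close>)
  moreover have "p \<in> axis_sim \<sigma> \<mu> t ` {x. x$2 = 0}" if "p$2 = 0" for p
    by (rule *) (use that in simp)
  ultimately show ?thesis using assms
    by (auto simp: img_def axis_circle_def x_axis_def axis_sim_def mult_less_0_iff)
qed

text \<open>Fixing the line makes A triangular, orthogonality makes it diagonal, and fixing the
  lower half-plane makes its second diagonal entry positive.\<close>

lemma similarity_fixing_axis:
  assumes "similarity \<Phi>" "img \<Phi> axis_circle = axis_circle"
  obtains \<sigma> \<mu> t where "\<sigma> = 1 \<or> \<sigma> = - 1" "0 < \<mu>" "\<Phi> = axis_sim \<sigma> \<mu> t"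
proof -
  obtain \<mu> A b where \<Phi>: "0 < \<mu>" "orthogonal_matrix A" "\<Phi> = (\<lambda>x. \<mu> *\<^sub>R (A *v x) + b)"
    using similarityE[OF assms(1)] .
  have ax: "(\<Phi> p)$2 = 0" if "p$2 = 0" for p
    using assms(2) that by (auto simp: img_def axis_circle_def x_axis_def)
  have lo: "(\<Phi> p)$2 < 0" if "p$2 < 0" for p
    using assms(2) that by (auto simp: img_def axis_circle_def x_axis_def)
  have b: "b$2 = 0" using ax[of 0] by (simp add: \<Phi>(3))
  have A21: "A$2$1 = 0" using ax[of "vector [1, 0]"] b \<Phi>(1)
    by (simp add: \<Phi>(3) matrix_vector_mult_def sum_2)
  have A22: "A$2$2 > 0" using lo[of "vector [0, -1]"] b \<Phi>(1)
    by (simp add: \<Phi>(3) matrix_vector_mult_def sum_2 zero_less_mult_iff)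
  have "transpose A ** A = mat 1" "A ** transpose A = mat 1" using \<Phi>(2) by (auto simp: orthogonal_matrix_def)
  hence o: "A$1$1 * A$1$1 = 1" "A$2$2 * A$2$2 = 1" "A$1$1 * A$1$2 = 0"
    using A21 by (auto simp: vec_eq_iff forall_2 matrix_matrix_mult_def sum_2 transpose_def mat_def)
  have "A$2$2 = 1 \<or> A$2$2 = - 1" "A$1$1 = 1 \<or> A$1$1 = - 1" using o square_eq_1_iff by blast+
  moreover have "\<Phi> = axis_sim (A$1$1) \<mu> (b$1)"
    using calculation A21 A22 b o
    by (auto simp: \<Phi>(3) fun_eq_iff axis_sim_def vec_eq_iff forall_2 matrix_vector_mult_def sum_2)
  ultimately show ?thesis using that \<Phi>(1) by blast
qed

section \<open>Integer matrices of determinant \<plusminus>1 and the similarities they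
  induce\<close>

definition unimodular_sends :: "real \<Rightarrow> real \<Rightarrow> int \<Rightarrow> int \<Rightarrow> int \<Rightarrow> int \<Rightarrow> bool" where
  "unimodular_sends \<alpha> \<beta> a b c d \<longleftrightarrow> (a * d - b * c)\<^sup>2 = 1 \<and> c * \<alpha> + d \<noteq> 0 \<and> (a * \<alpha> + b) / (c * \<alpha> + d) = \<beta>"

text \<open>Chosen to carry the two generating circles of \<open>pack \<beta>\<close> to the Ford
  circles of (a, b) and (c, d) in \<open>pack \<alpha>\<close>: the ratio turns curvature 1 into
  (c\<alpha> + d)^2, and the translation is the point where the first Ford circle touches the
  axis.\<close>

definition unimodular_sim :: "real \<Rightarrow> int \<Rightarrow> int \<Rightarrow> int \<Rightarrow> int \<Rightarrow> real^2 \<Rightarrow> real^2" where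
  "unimodular_sim \<alpha> a b c d = axis_sim (real_of_int (a * d - b * c)) (1 / (c * \<alpha> + d)\<^sup>2) (2 * b / (\<alpha> * (a * \<alpha> + b)))"

lemma unimodular_det: "unimodular_sends \<alpha> \<beta> a b c d \<Longrightarrow> real_of_int (a * d - b * c) = 1 \<or> real_of_int (a * d - b * c) = - 1"
proof -
  assume "unimodular_sends \<alpha> \<beta> a b c d"
  hence "a * d - b * c = 1 \<or> a * d - b * c = - 1" by (simp add: unimodular_sends_def power2_eq_1_iff)
  thus ?thesis by (elim disjE) (simp_all only: of_int_1 of_int_minus simp_thms)
qed

lemma unimodular_minus: "unimodular_sends \<alpha> \<beta> (- a) (- b) (- c) (- d) \<longleftrightarrow> unimodular_sends \<alpha> \<beta> a b c d"
proof -
  have m: "real_of_int (- a) * \<alpha> + real_of_int (- b) = - (a * \<alpha> + b)" for a b by simp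
  show ?thesis unfolding unimodular_sends_def m by (simp only: minus_divide_divide neg_equal_0_iff_equal minus_mult_minus)
qed

lemma unimodular_sim_minus: "unimodular_sim \<alpha> (- a) (- b) (- c) (- d) = unimodular_sim \<alpha> a b c d"
proof -
  have m: "real_of_int (- a) * \<alpha> + real_of_int (- b) = - (a * \<alpha> + b)" for a b by simp
  have "2 * real_of_int (- b) / (\<alpha> * - u) = 2 * b / (\<alpha> * u)" for u by simp
  thus ?thesis unfolding unimodular_sim_def m by (simp only: power2_minus minus_mult_minus of_int_mult of_int_numeral)
qed

lemma orientation_unimodular_sim:
  assumes "unimodular_sends \<alpha> \<beta> a b c d"
  shows "orientation_preserving (unimodular_sim \<alpha> a b c d) \<longleftrightarrow> a * d - b * c = 1"
proof -
  have "0 < 1 / (c * \<alpha> + d)\<^sup>2" using assms by (simp add: unimodular_sends_def)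
  hence "orientation_preserving (unimodular_sim \<alpha> a b c d) \<longleftrightarrow> real_of_int (a * d - b * c) = 1"
    unfolding unimodular_sim_def by (rule orientation_preserving_axis_sim[OF unimodular_det[OF assms]])
  thus ?thesis by (simp only: of_int_eq_1_iff)
qed

definition axis_sims :: "real \<Rightarrow> real \<Rightarrow> (real^2 \<Rightarrow> real^2) set" where
  "axis_sims \<alpha> \<beta> = {\<Phi>. similarity \<Phi> \<and> \<Phi> ` x_axis = x_axis \<and> image_packing \<Phi> (pack \<beta>) = pack \<alpha>}"

context
  fixes \<alpha> \<beta> :: real assumes \<alpha>: "0 < \<alpha>" and \<beta>: "0 < \<beta>"
begin

text \<open>The generators of \<open>pack \<beta>\<close> go to the Ford circles of a lattice basis
  and the axis, which generate \<open>pack \<alpha>\<close>.\<close>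

lemma unimodular_sim_mem:
  assumes "unimodular_sends \<alpha> \<beta> a b c d"
  shows "unimodular_sim \<alpha> a b c d \<in> axis_sims \<alpha> \<beta>"
proof -
  define u v D where "u = a * \<alpha> + b" and "v = c * \<alpha> + d" and "D = real_of_int (a * d - b * c)"
  have v: "v \<noteq> 0" "u / v = \<beta>" and d: "(a * d - b * c)\<^sup>2 = 1"
    using assms by (auto simp: unimodular_sends_def u_def v_def)
  have u: "u = \<beta> * v" "u \<noteq> 0" using v \<beta> by auto
  have s: "D = 1 \<or> D = - 1" "0 < 1 / v\<^sup>2" using unimodular_det[OF assms] v by (auto simp: D_def)
  let ?\<Phi> = "unimodular_sim \<alpha> a b c d"
  have \<Phi>: "?\<Phi> = axis_sim D (1 / v\<^sup>2) (2 * b / (\<alpha> * u))"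
    by (simp add: unimodular_sim_def u_def v_def D_def)
  have sim: "similarity ?\<Phi>" unfolding \<Phi> using similarity_axis_sim s by blast
  have ax: "img ?\<Phi> axis_circle = axis_circle" unfolding \<Phi> using img_axis_sim_axis_circle s by blast
  have "img ?\<Phi> (horocircle 0 (\<beta>\<^sup>2)) = circ_of (ford \<alpha> a b)"
    using ford_eq_horocircle[OF \<alpha>, of a b] u unfolding u_def[symmetric]
    unfolding \<Phi> img_axis_sim_horocircle[OF s] by (simp add: power_mult_distrib)
  moreover have "img ?\<Phi> (horocircle (2 / \<beta>) 1) = circ_of (ford \<alpha> c d)"
  proof -
    \<comment> \<open>After division by \<alpha> u v this says that the abscissa of the second
      generator is mapped correctly; it is why the sign of the similarity must be the
      determinant.\<close>
    have "\<alpha> * D + b * v = d * u" unfolding D_def u_def v_def by (simp add: algebra_simps)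
    hence "D / (u * v) + b / (\<alpha> * u) = d / (\<alpha> * v)"
      using u v \<alpha> by (simp add: field_simps)
    hence "2 * (D / (u * v)) + 2 * (b / (\<alpha> * u)) = 2 * (d / (\<alpha> * v))" by linarith
    moreover have "D * (1 / v\<^sup>2) * (2 / \<beta>) = 2 * (D / (u * v))"
      unfolding u(1) by (simp add: power2_eq_square mult_ac)
    ultimately have "D * (1 / v\<^sup>2) * (2 / \<beta>) + 2 * b / (\<alpha> * u) = 2 * d / (\<alpha> * v)" by simp
    thus ?thesis using ford_eq_horocircle[OF \<alpha>, of c d] v unfolding v_def[symmetric]
      unfolding \<Phi> img_axis_sim_horocircle[OF s] by simp
  qed
  ultimately have "image_packing ?\<Phi> (pack \<beta>)
      = generated_packing {circ_of (ford \<alpha> a b), circ_of (ford \<alpha> c d), axis_circle}"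
    unfolding pack_def image_packing_generated[OF sim] by (simp add: image_packing_img ax)
  also have "\<dots> = pack \<alpha>"
    using pack_generated_by_basis[OF \<alpha> d] by (simp add: axis_circle_eq_circ_of axis_vec_def)
  finally show ?thesis using sim ax by (simp add: axis_sims_def img_def axis_circle_def)
qed

text \<open>Preserving the axis as a set does not by itself exclude an exchange of the half-planes.
  The image lies in \<open>pack \<alpha>\<close>, however, and every line there other than
  \<open>axis_circle\<close> misses the origin.\<close>

lemma img_axis_eq_imp_fixing:
  assumes "similarity \<Phi>" "\<Phi> ` x_axis = x_axis" "image_packing \<Phi> (pack \<beta>) = pack \<alpha>"
  shows "img \<Phi> axis_circle = axis_circle"
proof -
  have "axis_circle \<in> pack \<beta>" unfolding pack_def by (rule subsetD[OF generated_packing_base]) simp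
  hence m: "img \<Phi> axis_circle \<in> pack \<alpha>" using assms(3) unfolding image_packing_img by blast
  have f: "fst (img \<Phi> axis_circle) = x_axis" using assms(2) by (simp add: img_def axis_circle_def)
  have "is_line x_axis" using is_circle_axis_circle is_line_circ_of[of 0 0 "-1" 0]
    by (simp flip: axis_circle_eq_circ_of) (simp add: axis_circle_def)
  hence "img \<Phi> axis_circle = axis_circle \<or>
      (\<exists>m n m' n' :: int. img \<Phi> axis_circle = circ_of (ford \<alpha> m n) \<and> m * \<alpha> + n = 0 \<and> (m * n' - n * m')\<^sup>2 = 1)"
    using line_in_pack[OF \<alpha> m] f by simp
  moreover have False if "img \<Phi> axis_circle = circ_of (ford \<alpha> m n)" "m * \<alpha> + n = 0" "(m * n' - n * m')\<^sup>2 = 1"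
    for m n m' n' :: int
  proof -
    have "n \<noteq> 0" using basis_pos(1)[OF \<alpha> that(3)] that(2) by auto
    hence "0 \<notin> fst (circ_of (ford \<alpha> m n))" using \<alpha> by (simp add: circ_of_def ford_def)
    thus False using that(1) f by (simp add: x_axis_def)
  qed
  ultimately show ?thesis by blast
qed

text \<open>The images of the two generators supply integer vectors. Comparing curvatures gives the
  fraction \<beta>, and comparing abscissae shows that the sign \<sigma> is the determinant, which
  is therefore \<plusminus>1.\<close>

lemma fixing_axis_imp_unimodular_sim:
  assumes "similarity \<Phi>" "img \<Phi> axis_circle = axis_circle" "image_packing \<Phi> (pack \<beta>) = pack \<alpha>"
  shows "\<exists>a b c d. unimodular_sends \<alpha> \<beta> a b c d \<and> \<Phi> = unimodular_sim \<alpha> a b c d"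
proof -
  obtain \<sigma> \<mu> t where \<Phi>: "\<sigma> = 1 \<or> \<sigma> = - 1" "0 < \<mu>" "\<Phi> = axis_sim \<sigma> \<mu> t"
    using similarity_fixing_axis[OF assms(1,2)] .
  have "horocircle 0 (\<beta>\<^sup>2) \<in> pack \<beta>" "horocircle (2 / \<beta>) 1 \<in> pack \<beta>"
    unfolding pack_def by (auto intro!: subsetD[OF generated_packing_base])
  hence "img \<Phi> (horocircle 0 (\<beta>\<^sup>2)) \<in> pack \<alpha>" "img \<Phi> (horocircle (2 / \<beta>) 1) \<in> pack \<alpha>"
    using assms(3) unfolding image_packing_img by blast+
  hence h: "horocircle t (\<beta>\<^sup>2 / \<mu>) \<in> pack \<alpha>" "horocircle (\<sigma> * \<mu> * (2 / \<beta>) + t) (1 / \<mu>) \<in> pack \<alpha>"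
    unfolding \<Phi>(3) img_axis_sim_horocircle[OF \<Phi>(1,2)] by simp_all
  obtain a b :: int where ab: "\<beta>\<^sup>2 / \<mu> = (a * \<alpha> + b)\<^sup>2" "t * (\<alpha> * (a * \<alpha> + b)) = 2 * b"
    using horocircle_in_pack[OF \<alpha> h(1)] \<beta> \<Phi>(2) by auto
  obtain c0 d0 :: int where cd0: "1 / \<mu> = (c0 * \<alpha> + d0)\<^sup>2"
      "(\<sigma> * \<mu> * (2 / \<beta>) + t) * (\<alpha> * (c0 * \<alpha> + d0)) = 2 * d0"
    using horocircle_in_pack[OF \<alpha> h(2)] \<Phi>(2) by auto
  define u where "u = a * \<alpha> + b"
  have "u\<^sup>2 = (\<beta> * (c0 * \<alpha> + d0))\<^sup>2" using ab(1) cd0(1) unfolding u_def by (simp add: power_mult_distrib flip: cd0(1))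
  hence "u = \<beta> * (c0 * \<alpha> + d0) \<or> u = - (\<beta> * (c0 * \<alpha> + d0))" by (simp only: power2_eq_iff)
  \<comment> \<open>Curvatures determine the linear forms up to sign only; the sign is absorbed into
    (c, d).\<close>
  then obtain s :: int where s: "s = 1 \<or> s = - 1" "u = s * (\<beta> * (c0 * \<alpha> + d0))"
    by (metis mult_1 mult_minus1 of_int_1 of_int_minus)
  define c d where "c = s * c0" and "d = s * d0"
  define v where "v = c * \<alpha> + d"
  have v: "v = s * (c0 * \<alpha> + d0)" by (simp add: v_def c_def d_def algebra_simps)
  have uv: "u = \<beta> * v" using s v by simp
  have "(real_of_int s)\<^sup>2 = 1" using s by auto
  hence mu: "1 / \<mu> = v\<^sup>2" unfolding v power_mult_distrib cd0(1) by simp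
  hence v0: "v \<noteq> 0" using \<Phi>(2) by auto
  have cd: "(\<sigma> * \<mu> * (2 / \<beta>) + t) * (\<alpha> * v) = 2 * d" using cd0(2) s unfolding v d_def by auto
  have mu': "\<mu> = 1 / v\<^sup>2" using mu \<Phi>(2) v0 by (simp add: field_simps)
  have u0: "u \<noteq> 0" using uv v0 \<beta> by simp
  have t: "t = 2 * b / (\<alpha> * u)" using ab(2) u0 \<alpha> unfolding u_def[symmetric] by (simp add: field_simps)
  have "\<sigma> * \<mu> * (2 / \<beta>) = 2 * \<sigma> / (u * v)"
    unfolding mu' uv by (simp add: power2_eq_square mult_ac)
  hence "(2 * \<sigma> / (u * v) + 2 * b / (\<alpha> * u)) * (\<alpha> * v) = 2 * d" using cd t by simp
  hence "(2 * \<alpha> * v) * (\<alpha> * \<sigma> + b * v) = (2 * \<alpha> * v) * (d * u)"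
    using u0 v0 \<alpha> by (simp add: field_simps)
  hence "\<alpha> * \<sigma> + b * v = d * u" using v0 \<alpha> by simp
  hence "\<alpha> * \<sigma> = \<alpha> * (a * d - b * c)" unfolding u_def v_def by (simp add: algebra_simps)
  hence \<sigma>: "\<sigma> = real_of_int (a * d - b * c)" using \<alpha> by simp
  hence "real_of_int ((a * d - b * c)\<^sup>2) = 1" using \<Phi>(1) by auto
  hence "(a * d - b * c)\<^sup>2 = 1" using of_int_eq_1_iff by blast
  hence "unimodular_sends \<alpha> \<beta> a b c d" using uv v0 unfolding unimodular_sends_def u_def[symmetric] v_def[symmetric] by simp
  moreover have "\<Phi> = unimodular_sim \<alpha> a b c d"
    unfolding unimodular_sim_def u_def[symmetric] v_def[symmetric] \<Phi>(3) t mu' \<sigma> by simp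
  ultimately show ?thesis by blast
qed

lemma axis_sims_iff: "\<Phi> \<in> axis_sims \<alpha> \<beta> \<longleftrightarrow> (\<exists>a b c d. unimodular_sends \<alpha> \<beta> a b c d \<and> \<Phi> = unimodular_sim \<alpha> a b c d)"
proof
  assume "\<Phi> \<in> axis_sims \<alpha> \<beta>"
  hence \<Phi>: "similarity \<Phi>" "\<Phi> ` x_axis = x_axis" "image_packing \<Phi> (pack \<beta>) = pack \<alpha>"
    by (auto simp: axis_sims_def)
  show "\<exists>a b c d. unimodular_sends \<alpha> \<beta> a b c d \<and> \<Phi> = unimodular_sim \<alpha> a b c d"
    by (rule fixing_axis_imp_unimodular_sim[OF \<Phi>(1) img_axis_eq_imp_fixing[OF \<Phi>] \<Phi>(3)])
qed (auto intro: unimodular_sim_mem)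

text \<open>The ratio fixes v and hence u = \<beta> v up to a common sign. Since \<alpha> may be
  rational, this does not yet fix the entries: the translation determines b, then u determines a,
  and the determinant together with v determines c and d.\<close>

lemma unimodular_sim_inj:
  assumes M: "unimodular_sends \<alpha> \<beta> a b c d" "unimodular_sends \<alpha> \<beta> a' b' c' d'"
    and eq: "unimodular_sim \<alpha> a b c d = unimodular_sim \<alpha> a' b' c' d'"
  shows "a' = a \<and> b' = b \<and> c' = c \<and> d' = d \<or> a' = - a \<and> b' = - b \<and> c' = - c \<and> d' = - d"
proof -
  define u v u' v' where uv: "u = a * \<alpha> + b" "v = c * \<alpha> + d" "u' = a' * \<alpha> + b'" "v' = c' * \<alpha> + d'"
  have "v \<noteq> 0" "u / v = \<beta>" "v' \<noteq> 0" "u' / v' = \<beta>" using M by (simp_all add: unimodular_sends_def uv)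
  hence v: "v \<noteq> 0" "u = \<beta> * v" "v' \<noteq> 0" "u' = \<beta> * v'" by (metis nonzero_divide_eq_eq)+
  hence u: "u \<noteq> 0" "u' \<noteq> 0" using \<beta> by auto
  note e = eq[unfolded unimodular_sim_def, folded uv]
  have "1 / v\<^sup>2 = 1 / v'\<^sup>2" using fun_cong[OF e, of "vector [0, 1]"] by (simp add: axis_sim_def vec_eq_iff forall_2)
  hence vv: "v\<^sup>2 = v'\<^sup>2" by simp
  have t: "2 * b / (\<alpha> * u) = 2 * b' / (\<alpha> * u')" using fun_cong[OF e, of 0] by (simp add: axis_sim_def vec_eq_iff forall_2)
  have "real_of_int (a * d - b * c) * (1 / v\<^sup>2) = real_of_int (a' * d' - b' * c') * (1 / v'\<^sup>2)"
    using fun_cong[OF e, of "vector [1, 0]"] t by (simp add: axis_sim_def vec_eq_iff forall_2)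
  hence D: "real_of_int (a * d - b * c) = real_of_int (a' * d' - b' * c')" using vv v by simp
  obtain s :: int where s: "s = 1 \<or> s = - 1" "v' = s * v"
    using vv unfolding power2_eq_iff by (metis mult_1 mult_minus1 of_int_1 of_int_minus minus_equation_iff)
  have us: "u' = s * u" using v s by simp
  have "b' = s * b"
  proof -
    have "b' * u = b * u'" using t u \<alpha> by (simp add: field_simps)
    hence "real_of_int b' = real_of_int (s * b)" using us u by simp
    thus ?thesis by linarith
  qed
  moreover have "a' = s * a"
  proof -
    have "\<alpha> * a' = \<alpha> * (s * a)" using us calculation unfolding uv by (simp add: algebra_simps)
    hence "real_of_int a' = real_of_int (s * a)" using \<alpha> by simp
    thus ?thesis by linarith
  qed
  moreover have "c' = s * c"
  proof -
    have ss: "real_of_int s * s = 1" using s by auto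
    \<comment> \<open>Equality of the v and of the determinants are two linear equations for the
      differences of c and d; eliminating that of d leaves the factor u \<noteq> 0.\<close>
    have "real_of_int d' - real_of_int s * d = - \<alpha> * (real_of_int c' - real_of_int s * c)" using s(2) unfolding uv by (simp add: algebra_simps)
    moreover have "real_of_int a * (real_of_int s * d' - real_of_int d) = real_of_int b * (real_of_int s * c' - real_of_int c)"
    proof -
      have "real_of_int a * d - b * c = s * a * d' - s * b * c'" using D \<open>a' = s * a\<close> \<open>b' = s * b\<close> by simp
      thus ?thesis by (simp add: algebra_simps)
    qed
    ultimately have "u * (real_of_int c' - real_of_int s * c) = 0" using ss unfolding uv by algebra
    hence "real_of_int c' = real_of_int (s * c)" using u by simp
    thus ?thesis by linarith
  qed
  moreover have "d' = s * d"
  proof -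
    have "real_of_int d' = real_of_int (s * d)" using s(2) calculation(3) unfolding uv by (simp add: algebra_simps)
    thus ?thesis by linarith
  qed
  ultimately show ?thesis using s(1) by auto
qed

end


section \<open>The modular group\<close>

text \<open>The adjugate matrix inverts the action. The product of the two denominators is the
  determinant, so the new one is nonzero too.\<close>

lemma unimodular_inverse:
  assumes "unimodular_sends \<beta> \<alpha> a b c d"
  shows "unimodular_sends \<alpha> \<beta> d (- b) (- c) a"
proof -
  define D v where "D = real_of_int (a * d - b * c)" and "v = c * \<beta> + d"
  have D: "D \<noteq> 0" using unimodular_det[OF assms] unfolding D_def by linarith
  have v: "v \<noteq> 0" "\<alpha> = (a * \<beta> + b) / v" and d: "(a * d - b * c)\<^sup>2 = 1"
    using assms by (auto simp: unimodular_sends_def v_def)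
  have av: "\<alpha> * v = a * \<beta> + b" using v by simp
  have "(real_of_int (- c) * \<alpha> + a) * v = D" "(d * \<alpha> + real_of_int (- b)) * v = \<beta> * D"
    using av unfolding D_def v_def of_int_diff of_int_mult of_int_minus by algebra+
  hence e: "real_of_int (- c) * \<alpha> + a = D / v" "d * \<alpha> + real_of_int (- b) = \<beta> * D / v"
    using v(1) by (metis nonzero_eq_divide_eq)+
  have "(d * a - - b * - c)\<^sup>2 = 1" using d by (simp add: mult.commute)
  thus ?thesis unfolding unimodular_sends_def e using D v(1) by simp
qed

section \<open>Half-turns exchanging the axis with a parallel line of the packing\<close>

definition half_turn :: "real \<Rightarrow> real \<Rightarrow> real^2 \<Rightarrow> real^2" where
  "half_turn c h p = vector [2 * c - p$1, h - p$2]"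

lemma half_turn_eq: "half_turn c h = (\<lambda>x. 1 *\<^sub>R (- mat 1 *v x) + vector [2 * c, h])"
  by (simp add: fun_eq_iff half_turn_def vec_eq_iff forall_2 matrix_vector_mult_def sum_2 mat_def)

lemma orthogonal_minus_mat: "orthogonal_matrix (- mat 1 :: real^2^2)"
  by (simp add: orthogonal_matrix_def vec_eq_iff forall_2 matrix_matrix_mult_def sum_2 transpose_def mat_def)

lemma half_turn_orientation: "similarity (half_turn c h)" "orientation_preserving (half_turn c h)"
proof -
  have "det (- mat 1 :: real^2^2) = 1" by (simp add: det_2 mat_def)
  thus "orientation_preserving (half_turn c h)"
    unfolding orientation_preserving_def
    by (intro exI[of _ 1] exI[of _ "- mat 1"] exI[of _ "vector [2 * c, h]"] conjI zero_less_one orthogonal_minus_mat half_turn_eq)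
  show "similarity (half_turn c h)"
    unfolding similarity_def
    by (intro exI[of _ 1] exI[of _ "- mat 1"] exI[of _ "vector [2 * c, h]"] conjI zero_less_one orthogonal_minus_mat half_turn_eq)
qed

lemma half_turn_image: "half_turn c h ` S = {p. half_turn c h p \<in> S}"
proof -
  have inv: "half_turn c h (half_turn c h p) = p" for p
    by (simp add: half_turn_def vec_eq_iff forall_2)
  have "p \<in> half_turn c h ` S" if "half_turn c h p \<in> S" for p
    using image_eqI[of p "half_turn c h" "half_turn c h p" S] that by (simp add: inv)
  thus ?thesis by (auto simp: inv)
qed

text \<open>The condition puts the centre of rotation (c, h/2) at the centre of the circle.\<close>

lemma half_turn_horocircle:
  assumes "h = 2 / k"
  shows "img (half_turn c h) (horocircle c k) = horocircle c k"
proof -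
  note b = similarity_ball_sphere[OF zero_less_one orthogonal_minus_mat half_turn_eq, of c h]
  have "half_turn c h (vector [c, 1 / k]) = vector [c, 1 / k]"
    using assms by (simp add: half_turn_def vec_eq_iff forall_2)
  thus ?thesis by (simp add: img_def horocircle_def b)
qed

text \<open>The second line is the Ford circle of (m, n). The circle of its partner (m', n') is
  inscribed in the strip between the two lines, and the half-turn about its centre permutes a
  generating triple.\<close>

lemma pack_half_turn:
  assumes \<alpha>: "0 < \<alpha>" and C: "C \<in> pack \<alpha>" "is_line (fst C)" "C \<noteq> axis_circle"
  shows "\<exists>R. similarity R \<and> orientation_preserving R \<and> img R C = axis_circle \<and> image_packing R (pack \<alpha>) = pack \<alpha>"
proof -
  obtain m n m' n' :: int where mn: "C = circ_of (ford \<alpha> m n)" "m * \<alpha> + n = 0" "(m * n' - n * m')\<^sup>2 = 1"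
    using line_in_pack[OF \<alpha> C(1,2)] C(3) by blast
  define v h c where "v = m' * \<alpha> + n'" and "h = 2 * (real_of_int n)\<^sup>2 / \<alpha>\<^sup>2" and "c = 2 * n' / (\<alpha> * v)"
  have v0: "v \<noteq> 0" using basis_pos(2)[OF \<alpha> mn(3)] mn(2) by (simp add: v_def)
  have "real_of_int ((m * n' - n * m')\<^sup>2) = 1" using mn(3) by simp
  \<comment> \<open>As m\<alpha> = -n, the number n v is \<alpha> times the determinant up to sign.
    Hence the height of the strip is the diameter 2 / v^2 of the inscribed circle.\<close>
  hence "(real_of_int n * v)\<^sup>2 = \<alpha>\<^sup>2" using mn(2) unfolding v_def by simp algebra
  hence h: "h = 2 / v\<^sup>2" using v0 \<alpha> by (simp add: h_def field_simps power_mult_distrib)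
  let ?R = "half_turn c h"
  have ax: "img ?R axis_circle = C"
    unfolding img_def half_turn_image
    by (auto simp: axis_circle_def x_axis_def half_turn_def mn circ_of_def ford_def h_def)
  have inv: "img ?R (img ?R D) = D" for D
  proof -
    have "vector [p$1, p$2] = p" for p :: "real^2" by (simp add: vec_eq_iff forall_2)
    thus ?thesis by (simp add: img_def half_turn_image) (simp add: half_turn_def)
  qed
  hence "img ?R C = axis_circle" using ax by metis
  moreover have Y: "circ_of (ford \<alpha> m' n') = horocircle c (v\<^sup>2)"
    using ford_eq_horocircle[OF \<alpha>, of m' n'] v0 by (simp add: c_def flip: v_def)
  moreover have "img ?R (horocircle c (v\<^sup>2)) = horocircle c (v\<^sup>2)"
    by (rule half_turn_horocircle[OF h])
  moreover have "pack \<alpha> = generated_packing {C, horocircle c (v\<^sup>2), axis_circle}"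
    using pack_generated_by_basis[OF \<alpha> mn(3)] by (simp add: Y mn(1) axis_circle_eq_circ_of axis_vec_def)
  ultimately have "image_packing ?R (pack \<alpha>) = pack \<alpha>"
    using image_packing_generated[OF half_turn_orientation(1), of c h "{C, horocircle c (v\<^sup>2), axis_circle}"] ax
    by (simp add: image_packing_img insert_commute)
  thus ?thesis using half_turn_orientation \<open>img ?R C = axis_circle\<close> by blast
qed

text \<open>If the axis goes to another line, compose with the half-turn that brings this line back;
  a half-turn does not affect orientation.\<close>

lemma similar_imp_axis_sim:
  assumes \<alpha>: "0 < \<alpha>" and \<beta>: "0 < \<beta>" and \<Phi>: "similarity \<Phi>" "image_packing \<Phi> (pack \<beta>) = pack \<alpha>"
  obtains \<Phi>' where "\<Phi>' \<in> axis_sims \<alpha> \<beta>" "orientation_preserving \<Phi> \<longrightarrow> orientation_preserving \<Phi>'"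
proof -
  have mem: "\<Phi>' \<in> axis_sims \<alpha> \<beta>"
    if "similarity \<Phi>'" "image_packing \<Phi>' (pack \<beta>) = pack \<alpha>" "img \<Phi>' axis_circle = axis_circle" for \<Phi>'
    using that by (simp add: axis_sims_def img_def axis_circle_def)
  define C where "C = img \<Phi> axis_circle"
  show ?thesis
  proof (cases "C = axis_circle")
    case True
    hence "\<Phi> \<in> axis_sims \<alpha> \<beta>" using mem[OF \<Phi>] C_def by simp
    thus ?thesis using that by blast
  next
    case False
    have "axis_circle \<in> pack \<beta>" unfolding pack_def by (rule subsetD[OF generated_packing_base]) simp
    hence "C \<in> pack \<alpha>" using \<Phi>(2) unfolding image_packing_img C_def by blast
    moreover have "is_line x_axis"
      using is_line_circ_of[of 0 0 "- 1" 0] by (simp flip: axis_circle_eq_circ_of) (simp add: axis_circle_def)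
    hence "is_line (fst C)" unfolding C_def img_def axis_circle_def using is_line_similarity[OF \<Phi>(1)] by simp
    ultimately obtain R where R: "similarity R" "orientation_preserving R" "img R C = axis_circle"
      "image_packing R (pack \<alpha>) = pack \<alpha>"
      using pack_half_turn[OF \<alpha>] False by blast
    have "R \<circ> \<Phi> \<in> axis_sims \<alpha> \<beta>"
    proof (rule mem)
      show "similarity (R \<circ> \<Phi>)" by (rule similarity_comp[OF \<Phi>(1) R(1)])
      show "img (R \<circ> \<Phi>) axis_circle = axis_circle" using R(3) by (simp add: img_comp C_def)
      have "image_packing (R \<circ> \<Phi>) (pack \<beta>) = image_packing R (image_packing \<Phi> (pack \<beta>))"
        by (simp add: image_packing_img image_image img_comp)
      thus "image_packing (R \<circ> \<Phi>) (pack \<beta>) = pack \<alpha>" by (simp add: \<Phi>(2) R(4))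
    qed
    thus ?thesis using that orientation_preserving_comp R(2) by blast
  qed
qed

text \<open>A similarity from \<open>pack \<alpha>\<close> to \<open>pack \<beta>\<close> belongs to
  \<open>axis_sims \<beta> \<alpha>\<close> after the reduction to the axis, so its matrix sends
  \<beta> to \<alpha>. The adjugate reverses the direction and keeps the determinant.\<close>

lemma similar_iff_unimodular:
  assumes \<alpha>: "0 < \<alpha>" and \<beta>: "0 < \<beta>"
  shows "similar (pack \<alpha>) (pack \<beta>) \<longleftrightarrow> (\<exists>a b c d. unimodular_sends \<alpha> \<beta> a b c d)"
    and "properly_similar (pack \<alpha>) (pack \<beta>) \<longleftrightarrow> (\<exists>a b c d. unimodular_sends \<alpha> \<beta> a b c d \<and> a * d - b * c = 1)"
proof -
  have 1: "\<exists>a b c d. unimodular_sends \<alpha> \<beta> a b c d \<and> (orientation_preserving \<Phi> \<longrightarrow> a * d - b * c = 1)"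
    if s: "similarity \<Phi>" "pack \<beta> = image_packing \<Phi> (pack \<alpha>)" for \<Phi>
  proof -
    obtain \<Phi>' where "\<Phi>' \<in> axis_sims \<beta> \<alpha>" and o: "orientation_preserving \<Phi> \<longrightarrow> orientation_preserving \<Phi>'"
      using similar_imp_axis_sim[OF \<beta> \<alpha> s(1) s(2)[symmetric]] .
    then obtain a b c d where m: "unimodular_sends \<beta> \<alpha> a b c d" "\<Phi>' = unimodular_sim \<beta> a b c d"
      unfolding axis_sims_iff[OF \<beta> \<alpha>] by blast
    have "orientation_preserving \<Phi> \<longrightarrow> d * a - - b * - c = 1"
      using o orientation_unimodular_sim[OF m(1)] m(2) by (simp add: mult.commute)
    thus ?thesis using unimodular_inverse[OF m(1)] by blast
  qed
  have 2: "\<exists>\<Phi>. similarity \<Phi> \<and> (a * d - b * c = 1 \<longrightarrow> orientation_preserving \<Phi>) \<and> pack \<beta> = image_packing \<Phi> (pack \<alpha>)"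
    if m: "unimodular_sends \<alpha> \<beta> a b c d" for a b c d
  proof -
    note m' = unimodular_inverse[OF m]
    have "unimodular_sim \<beta> d (- b) (- c) a \<in> axis_sims \<beta> \<alpha>" by (rule unimodular_sim_mem[OF \<beta> \<alpha> m'])
    moreover have "a * d - b * c = 1 \<longrightarrow> orientation_preserving (unimodular_sim \<beta> d (- b) (- c) a)"
      using orientation_unimodular_sim[OF m'] by (simp add: mult.commute)
    ultimately show ?thesis by (auto simp: axis_sims_def)
  qed
  show "similar (pack \<alpha>) (pack \<beta>) \<longleftrightarrow> (\<exists>a b c d. unimodular_sends \<alpha> \<beta> a b c d)"
    unfolding similar_def using 1 2 by blast
  show "properly_similar (pack \<alpha>) (pack \<beta>) \<longleftrightarrow> (\<exists>a b c d. unimodular_sends \<alpha> \<beta> a b c d \<and> a * d - b * c = 1)"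
    unfolding properly_similar_def using 1 2 by blast
qed

section \<open>Integer matrices modulo sign and the final bijection\<close>

lemma invertible_int_iff: "invertible M \<longleftrightarrow> (det M)\<^sup>2 = 1" for M :: "int^2^2"
proof
  assume "invertible M"
  then obtain N where "M ** N = mat 1" unfolding invertible_def by blast
  hence "det M * det N = 1" by (metis det_I det_mul)
  hence "det M dvd 1" by (metis dvd_triv_left)
  thus "(det M)\<^sup>2 = 1" by (auto simp: power2_eq_1_iff)
next
  assume d: "(det M)\<^sup>2 = 1"
  \<comment> \<open>The adjugate times \<open>det M\<close>, which is its own inverse here.\<close>
  define N :: "int^2^2" where "N = vector [vector [det M * M$2$2, - det M * M$1$2], vector [- det M * M$2$1, det M * M$1$1]]"
  have "M ** N = mat 1" "N ** M = mat 1"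
    using d unfolding vec_eq_iff forall_2 matrix_matrix_mult_def N_def det_2 mat_def
    by (simp_all add: sum_2 power2_eq_square algebra_simps)
  thus "invertible M" unfolding invertible_def by blast
qed

lemma GL2Z_coset: "{mat 1, - mat 1} #>\<^bsub>GL2Z\<^esub> M = {M, - M}" for M :: "int^2^2"
proof -
  have "- mat 1 ** M = - M"
    by (simp add: vec_eq_iff forall_2 matrix_matrix_mult_def sum_2 mat_def)
  thus ?thesis by (auto simp: r_coset_def GL2Z_def)
qed

lemma carrier_PGL2Z: "carrier PGL2Z = {{M, - M} | M :: int^2^2. (det M)\<^sup>2 = 1}"
  by (auto simp: PGL2Z_def FactGroup_def RCOSETS_def GL2Z_coset) (auto simp: GL2Z_def invertible_int_iff)

lemma det_uminus_2: "det (- M) = det M" for M :: "int^2^2"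
  by (simp add: det_2)

lemma mem_PSL2Z: "{M, - M} \<in> PSL2Z \<longleftrightarrow> det M = 1" for M :: "int^2^2"
proof
  assume "{M, - M} \<in> PSL2Z"
  then obtain N where "{M, - M} = {N, - N}" "det N = 1" unfolding PSL2Z_def GL2Z_coset by blast
  thus "det M = 1" using det_uminus_2 by (metis doubleton_eq_iff)
next
  assume "det M = 1"
  moreover have "M \<in> carrier GL2Z" using calculation by (simp add: GL2Z_def invertible_int_iff)
  ultimately show "{M, - M} \<in> PSL2Z" unfolding PSL2Z_def GL2Z_coset by blast
qed

abbreviation matrix_sends :: "real \<Rightarrow> real \<Rightarrow> int^2^2 \<Rightarrow> bool" where
  "matrix_sends \<alpha> \<beta> M \<equiv> unimodular_sends \<alpha> \<beta> (M$1$1) (M$1$2) (M$2$1) (M$2$2)"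

abbreviation matrix_sim :: "real \<Rightarrow> int^2^2 \<Rightarrow> real^2 \<Rightarrow> real^2" where
  "matrix_sim \<alpha> M \<equiv> unimodular_sim \<alpha> (M$1$1) (M$1$2) (M$2$1) (M$2$2)"

lemma moebius_sends_iff:
  fixes M :: "int^2^2"
  assumes "(det M)\<^sup>2 = 1"
  shows "moebius_sends {M, - M} \<alpha> \<beta> \<longleftrightarrow> matrix_sends \<alpha> \<beta> M"
proof -
  have "(M$1$1 * M$2$2 - M$1$2 * M$2$1)\<^sup>2 = 1" using assms by (simp add: det_2)
  moreover have "matrix_sends \<alpha> \<beta> (- M) \<longleftrightarrow> matrix_sends \<alpha> \<beta> M" by (simp add: unimodular_minus)
  ultimately show ?thesis unfolding moebius_sends_def by (auto simp: unimodular_sends_def)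
qed

text \<open>Sending a similarity to the set of all matrices that induce it avoids choosing a
  representative. By \<open>unimodular_sim_inj\<close> this set is exactly a class {M, -M}.\<close>

lemma axis_sims_bij:
  assumes \<alpha>: "0 < \<alpha>" and \<beta>: "0 < \<beta>"
  defines "F \<equiv> \<lambda>\<Phi>. {M :: int^2^2. matrix_sends \<alpha> \<beta> M \<and> matrix_sim \<alpha> M = \<Phi>}"
  shows "bij_betw F (axis_sims \<alpha> \<beta>) {g \<in> carrier PGL2Z. moebius_sends g \<alpha> \<beta>}"
    and "\<Phi> \<in> axis_sims \<alpha> \<beta> \<Longrightarrow> orientation_preserving \<Phi> \<longleftrightarrow> F \<Phi> \<in> PSL2Z"
proof -
  have F: "F (matrix_sim \<alpha> M) = {M, - M}" if M: "matrix_sends \<alpha> \<beta> M" for M :: "int^2^2"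
  proof
    show "{M, - M} \<subseteq> F (matrix_sim \<alpha> M)"
      using M by (simp add: F_def unimodular_minus unimodular_sim_minus)
    show "F (matrix_sim \<alpha> M) \<subseteq> {M, - M}"
    proof
      fix N assume "N \<in> F (matrix_sim \<alpha> M)"
      hence "matrix_sends \<alpha> \<beta> N" "matrix_sim \<alpha> M = matrix_sim \<alpha> N" by (auto simp: F_def)
      from unimodular_sim_inj[OF \<alpha> \<beta> M this] show "N \<in> {M, - M}" by (auto simp: vec_eq_iff forall_2)
    qed
  qed
  have ex: "\<exists>M :: int^2^2. matrix_sends \<alpha> \<beta> M \<and> \<Phi> = matrix_sim \<alpha> M" if mem: "\<Phi> \<in> axis_sims \<alpha> \<beta>" for \<Phi>
  proof -
    obtain a b c d where "unimodular_sends \<alpha> \<beta> a b c d" "\<Phi> = unimodular_sim \<alpha> a b c d"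
      using mem unfolding axis_sims_iff[OF \<alpha> \<beta>] by blast
    thus ?thesis by (intro exI[of _ "vector [vector [a, b], vector [c, d]]"]) simp
  qed
  have det: "(det M)\<^sup>2 = 1" if "matrix_sends \<alpha> \<beta> M" for M :: "int^2^2"
    using that by (simp add: unimodular_sends_def det_2)
  show "bij_betw F (axis_sims \<alpha> \<beta>) {g \<in> carrier PGL2Z. moebius_sends g \<alpha> \<beta>}"
  proof (rule bij_betw_imageI)
    show "inj_on F (axis_sims \<alpha> \<beta>)"
    proof (rule inj_onI)
      fix \<Phi> \<Phi>' assume m: "\<Phi> \<in> axis_sims \<alpha> \<beta>" and e: "F \<Phi> = F \<Phi>'"
      obtain M where "matrix_sends \<alpha> \<beta> M" "\<Phi> = matrix_sim \<alpha> M" using ex[OF m] by blast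
      hence "M \<in> F \<Phi>'" unfolding e[symmetric] by (simp add: F_def)
      thus "\<Phi> = \<Phi>'" using \<open>\<Phi> = matrix_sim \<alpha> M\<close> by (simp add: F_def)
    qed
    show "F ` axis_sims \<alpha> \<beta> = {g \<in> carrier PGL2Z. moebius_sends g \<alpha> \<beta>}"
    proof safe
      fix \<Phi> assume "\<Phi> \<in> axis_sims \<alpha> \<beta>"
      then obtain M where M: "matrix_sends \<alpha> \<beta> M" "\<Phi> = matrix_sim \<alpha> M" using ex by blast
      hence "F \<Phi> = {M, - M}" using F by simp
      thus "F \<Phi> \<in> carrier PGL2Z" "moebius_sends (F \<Phi>) \<alpha> \<beta>"
        using det[OF M(1)] M(1) moebius_sends_iff unfolding carrier_PGL2Z by auto
    next
      fix g assume "g \<in> carrier PGL2Z" "moebius_sends g \<alpha> \<beta>"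
      then obtain M where M: "g = {M, - M}" "matrix_sends \<alpha> \<beta> M"
        unfolding carrier_PGL2Z using moebius_sends_iff by auto
      hence "g = F (matrix_sim \<alpha> M)" "matrix_sim \<alpha> M \<in> axis_sims \<alpha> \<beta>"
        using F unimodular_sim_mem[OF \<alpha> \<beta>] by auto
      thus "g \<in> F ` axis_sims \<alpha> \<beta>" by blast
    qed
  qed
  show "orientation_preserving \<Phi> \<longleftrightarrow> F \<Phi> \<in> PSL2Z" if mem: "\<Phi> \<in> axis_sims \<alpha> \<beta>"
  proof -
    obtain M where M: "matrix_sends \<alpha> \<beta> M" "\<Phi> = matrix_sim \<alpha> M" using ex[OF mem] by blast
    thus ?thesis using F orientation_unimodular_sim[OF M(1)] mem_PSL2Z[of M] by (simp add: det_2)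
  qed
qed

theorem theorem1p1:
  fixes \<alpha> \<beta> :: real
  assumes "0 < \<alpha>" and "0 < \<beta>"
  shows "(\<exists>F. bij_betw F
              {\<Phi>. similarity \<Phi> \<and> \<Phi> ` x_axis = x_axis \<and> image_packing \<Phi> (pack \<beta>) = pack \<alpha>}
              {g \<in> carrier PGL2Z. moebius_sends g \<alpha> \<beta>} \<and>
            (\<forall>\<Phi>. similarity \<Phi> \<and> \<Phi> ` x_axis = x_axis \<and> image_packing \<Phi> (pack \<beta>) = pack \<alpha> \<longrightarrow>
              (orientation_preserving \<Phi> \<longleftrightarrow> F \<Phi> \<in> PSL2Z))) \<and>
         (similar (pack \<alpha>) (pack \<beta>) \<longleftrightarrow>
            (\<exists>a b c d :: int. (a * d - b * c = 1 \<or> a * d - b * c = -1) \<and>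
              of_int c * \<alpha> + of_int d \<noteq> 0 \<and>
              (of_int a * \<alpha> + of_int b) / (of_int c * \<alpha> + of_int d) = \<beta>)) \<and>
         (properly_similar (pack \<alpha>) (pack \<beta>) \<longleftrightarrow>
            (\<exists>a b c d :: int. a * d - b * c = 1 \<and>
              of_int c * \<alpha> + of_int d \<noteq> 0 \<and>
              (of_int a * \<alpha> + of_int b) / (of_int c * \<alpha> + of_int d) = \<beta>))"
proof (intro conjI)
  show "\<exists>F. bij_betw F
              {\<Phi>. similarity \<Phi> \<and> \<Phi> ` x_axis = x_axis \<and> image_packing \<Phi> (pack \<beta>) = pack \<alpha>}
              {g \<in> carrier PGL2Z. moebius_sends g \<alpha> \<beta>} \<and>
            (\<forall>\<Phi>. similarity \<Phi> \<and> \<Phi> ` x_axis = x_axis \<and> image_packing \<Phi> (pack \<beta>) = pack \<alpha> \<longrightarrow>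
              (orientation_preserving \<Phi> \<longleftrightarrow> F \<Phi> \<in> PSL2Z))"
    using axis_sims_bij(1)[OF assms] axis_sims_bij(2)[OF assms] unfolding axis_sims_def by blast
qed (simp_all only: similar_iff_unimodular[OF assms] unimodular_sends_def power2_eq_1_iff conj_assoc, auto)


end
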